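(* Let $\overline\mu=(\overline\mu_a)_{a\in\mathcal A}$ be the vector of Rauzy measures corresponding to a compatible, irreducible Pisot random substitution $\vartheta_{\mathbf P}=(\vartheta,\mathbf P)$ on $\mathcal A=\{1,\dots,d\}$. Then each of the measures $\overline\mu_a$, $a\in\mathcal A$, is absolutely continuous with respect to Lebesgue measure on $\mathbb H$, with density bounded above by $D$, where $D$ is the density of points in the lattice $\mathcal J$.
   Context: Let $\mathcal A^+$ be the set of non-empty finite words over $\mathcal A$, $|u|$ the length of $u$, $|u|_i$ the number of occurrences of $i$ in $u$, $\psi(u)=(|u|_1,\dots,|u|_d)^T$, and $u_{[1,m]}=u_1\cdots u_m$ (empty if $m=0$). A random substitution $\vartheta_{\mathbf P}=(\vartheta,\mathbf P)$ is a map $\vartheta$ assigning to each letter $i$ a non-empty finite set $\vartheta(i)\subset\mathcal A^+$ together with probability vectors $p_i\colon\vartheta(i)\to(0,1]$, $\sum_{v\in\vartheta(i)}p_i(v)=1$. For a word $u=u_1\cdots u_n$, $\vartheta_{\mathbf P}(u)$ is the random word obtained by independently replacing each letter $u_k$ by $v\in\vartheta(u_k)$ with probability $p_{u_k}(v)$ and concatenating in order; $(\vartheta_{\mathbf P}^n(u))_{n\ge0}$ is the Markov chain on $\mathcal A^+$ started at $u$ with these transition probabilities, and $\mathbb E$ is the corresponding expectation. It is compatible if $\psi(u)=\psi(v)$ for all $a\in\mathcal A$, $u,v\in\vartheta(a)$; then all realisations of $\vartheta_{\mathbf P}^n(v)$ have a common length $|\vartheta^n(v)|$, and the substitution matrix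 is $M_{i,j}=|v|_i$ for any $v\in\vartheta(j)$. It is primitive if $M$ is primitive with Perron–Frobenius eigenvalue $\lambda>1$. A compatible primitive random substitution is irreducible Pisot if $\lambda$ is a Pisot number and the characteristic polynomial of $M$ is irreducible over $\mathbb Z$. $\mathbf L,\mathbf R$ are left and right Perron–Frobenius eigenvectors of $M$ with $\|\mathbf R\|_1=1=\mathbf L^T\mathbf R$; $\mathbb H\subset\mathbb R^d$ is the hyperplane orthogonal to $\mathbf L$; $\pi$ is the linear projection along $\mathbf R$ onto $\mathbb H$. For a finite word $w$ and $a\in\mathcal A$, $\mu_a(w)=\sum_{0\le m\le|w|-1,\ w_{m+1}=a}\delta_{\pi(\psi(w_{[1,m]}))}$. The Rauzy measure $\overline\mu_a$ is the weak limit $\overline\mu_a=\lim_{n\to\infty}|\vartheta^n(v)|^{-1}\,\mathbb E[\mu_a(\vartheta_{\mathbf P}^n(v))]$, which exists and is the same for every $v\in\mathcal A^+$. $\mathcal J\subset\mathbb H$ is the lattice given by the integer span of $\pi(\mathbf e_i-\mathbf e_1)$, $2\le i\le d$, with $(\mathbf e_i)$ the standard basis of $\mathbb R^d$; its density $D$ is the reciprocal of the Lebesgue measure of a fundamental domain. *)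

theory Defs
  imports
    "HOL-Probability.Probability"
    "HOL-Computational_Algebra.Computational_Algebra"
begin

text \<open>
  The alphabet \<open>{1,\<dots>,d}\<close> is an arbitrary finite type \<open>'d\<close>, words are lists over it, and
  \<open>\<real>\<^sup>d\<close> is \<open>real ^ 'd\<close>.
\<close>

section \<open>Random substitutions\<close>

text \<open>
  A random substitution is a family of probability mass functions on words: \<open>\<theta> i\<close> has the set of
  images of the letter \<open>i\<close> as its support and the probabilities of these images as its weights,
  which are thus automatically strictly positive and sum to one.
\<close>

definition random_substitution :: "('d \<Rightarrow> 'd list pmf) \<Rightarrow> bool" where
  "random_substitution \<theta> \<longleftrightarrow> (\<forall>i. finite (set_pmf (\<theta> i)) \<and> [] \<notin> set_pmf (\<theta> i))"

primrec subst_word :: "('d \<Rightarrow> 'd list pmf) \<Rightarrow> 'd list \<Rightarrow> 'd list pmf" where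
  "subst_word \<theta> [] = return_pmf []"
| "subst_word \<theta> (a # u) =
     bind_pmf (\<theta> a) (\<lambda>v. bind_pmf (subst_word \<theta> u) (\<lambda>w. return_pmf (v @ w)))"

primrec subst_iter :: "('d \<Rightarrow> 'd list pmf) \<Rightarrow> nat \<Rightarrow> 'd list \<Rightarrow> 'd list pmf" where
  "subst_iter \<theta> 0 u = return_pmf u"
| "subst_iter \<theta> (Suc n) u = bind_pmf (subst_iter \<theta> n u) (subst_word \<theta>)"

definition abelianise :: "'d list \<Rightarrow> real ^ 'd" where
  "abelianise u = (\<chi> i. real (count_list u i))"

definition compatible :: "('d \<Rightarrow> 'd list pmf) \<Rightarrow> bool" where
  "compatible \<theta> \<longleftrightarrow>
     (\<forall>a. \<forall>u\<in>set_pmf (\<theta> a). \<forall>v\<in>set_pmf (\<theta> a). \<forall>i. count_list u i = count_list v i)"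

text \<open>For compatible \<open>\<theta>\<close> the following two notions do not depend on the realisation.\<close>

definition iter_length :: "('d \<Rightarrow> 'd list pmf) \<Rightarrow> nat \<Rightarrow> 'd list \<Rightarrow> nat" where
  "iter_length \<theta> n v = the_elem (length ` set_pmf (subst_iter \<theta> n v))"

definition subst_matrix :: "('d::finite \<Rightarrow> 'd list pmf) \<Rightarrow> int ^ 'd ^ 'd" where
  "subst_matrix \<theta> = (\<chi> i j. int (count_list (SOME v. v \<in> set_pmf (\<theta> j)) i))"


section \<open>Perron--Frobenius data and the Pisot property\<close>

definition primitive_matrix :: "int ^ 'd ^ 'd::finite \<Rightarrow> bool" where
  "primitive_matrix M \<longleftrightarrow> (\<exists>k>0. \<forall>i j. (((**) M ^^ k) (mat 1)) $ i $ j > 0)"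

definition of_int_matrix :: "int ^ 'd ^ 'd \<Rightarrow> 'a::ring_1 ^ 'd ^ 'd" where
  "of_int_matrix M = (\<chi> i j. of_int (M $ i $ j))"

definition matrix_eigenvalue :: "complex ^ 'd ^ 'd::finite \<Rightarrow> complex \<Rightarrow> bool" where
  "matrix_eigenvalue M z \<longleftrightarrow> (\<exists>x. x \<noteq> 0 \<and> M *v x = z *s x)"

text \<open>The Perron--Frobenius eigenvalue: the spectral radius, which is itself an eigenvalue.\<close>

definition pf_eigenvalue :: "int ^ 'd ^ 'd::finite \<Rightarrow> real \<Rightarrow> bool" where
  "pf_eigenvalue M l \<longleftrightarrow>
     matrix_eigenvalue (of_int_matrix M) (complex_of_real l) \<and>
     (\<forall>z. matrix_eigenvalue (of_int_matrix M) z \<longrightarrow> cmod z \<le> l)"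

definition pf_eigenvectors :: "int ^ 'd ^ 'd::finite \<Rightarrow> real ^ 'd \<Rightarrow> real ^ 'd \<Rightarrow> bool" where
  "pf_eigenvectors M L R \<longleftrightarrow>
     (\<exists>l. pf_eigenvalue M l \<and> L v* of_int_matrix M = l *s L \<and> of_int_matrix M *v R = l *s R) \<and>
     (\<forall>i. L $ i > 0) \<and> (\<forall>i. R $ i > 0) \<and>
     (\<Sum>i\<in>UNIV. \<bar>R $ i\<bar>) = 1 \<and> L \<bullet> R = 1"

definition char_polynomial :: "int ^ 'd ^ 'd::finite \<Rightarrow> int poly" where
  "char_polynomial M = det (\<chi> i j. (if i = j then [:0, 1:] else 0) - [:M $ i $ j:])"

text \<open>The algebraic conjugates are the complex roots of the minimal polynomial \<open>p\<close>.\<close>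

definition pisot_number :: "real \<Rightarrow> bool" where
  "pisot_number l \<longleftrightarrow> l > 1 \<and>
     (\<exists>p :: int poly. lead_coeff p = 1 \<and> irreducible p \<and>
        poly (map_poly of_int p) (complex_of_real l) = 0 \<and>
        (\<forall>z. poly (map_poly of_int p) z = 0 \<and> z \<noteq> complex_of_real l \<longrightarrow> cmod z < 1))"

definition irreducible_pisot :: "('d::finite \<Rightarrow> 'd list pmf) \<Rightarrow> bool" where
  "irreducible_pisot \<theta> \<longleftrightarrow>
     primitive_matrix (subst_matrix \<theta>) \<and>
     (\<exists>l. pf_eigenvalue (subst_matrix \<theta>) l \<and> pisot_number l) \<and>
     irreducible (char_polynomial (subst_matrix \<theta>))"


section \<open>The hyperplane, its Lebesgue measure and the lattice\<close>

definition hyperplane :: "real ^ 'd::finite \<Rightarrow> (real ^ 'd) set" where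
  "hyperplane L = {x. L \<bullet> x = 0}"

definition proj :: "real ^ 'd::finite \<Rightarrow> real ^ 'd \<Rightarrow> real ^ 'd \<Rightarrow> real ^ 'd" where
  "proj L R x = x - (L \<bullet> x) *\<^sub>R R"

lemma proj_iff:
  assumes "L \<bullet> R = 1"
  shows "y = proj L R x \<longleftrightarrow> y \<in> hyperplane L \<and> (\<exists>t. x - y = t *\<^sub>R R)"
proof
  assume "y = proj L R x"
  then show "y \<in> hyperplane L \<and> (\<exists>t. x - y = t *\<^sub>R R)"
    using assms by (auto simp: proj_def hyperplane_def inner_diff_right)
next
  assume "y \<in> hyperplane L \<and> (\<exists>t. x - y = t *\<^sub>R R)"
  then obtain t where y: "L \<bullet> y = 0" "x - y = t *\<^sub>R R"
    by (auto simp: hyperplane_def)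
  have "L \<bullet> x - L \<bullet> y = L \<bullet> (t *\<^sub>R R)"
    unfolding y(2)[symmetric] by (rule inner_diff_right[symmetric])
  then have "L \<bullet> x = t"
    using assms y(1) by simp
  then show "y = proj L R x"
    using y by (simp add: proj_def algebra_simps)
qed

text \<open>
  Lebesgue measure on a linear subspace \<open>S\<close>, as a measure on the ambient space: the image of
  the product Lebesgue measure under the isometry given by an orthonormal basis of \<open>S\<close> (compare
  the definition of \<^const>\<open>lborel\<close>). It does not depend on the chosen basis; for \<open>S = {0}\<close>
  it is the unit mass at \<open>0\<close>.
\<close>

definition lborel_subspace :: "'a::euclidean_space set \<Rightarrow> 'a measure" where
  "lborel_subspace S =
     (let B = (SOME B. B \<subseteq> S \<and> pairwise orthogonal B \<and> (\<forall>b\<in>B. norm b = 1) \<and> span B = S)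
      in distr (\<Pi>\<^sub>M b\<in>B. lborel) borel (\<lambda>c. \<Sum>b\<in>B. c b *\<^sub>R b))"

text \<open>The lattice is independent of the choice of the reference letter \<open>r\<close> (the letter \<open>1\<close>).\<close>

definition rauzy_lattice :: "real ^ 'd::finite \<Rightarrow> real ^ 'd \<Rightarrow> 'd \<Rightarrow> (real ^ 'd) set" where
  "rauzy_lattice L R r =
     {\<Sum>i\<in>UNIV - {r}. of_int (c i) *\<^sub>R proj L R (axis i 1 - axis r 1) | c :: 'd \<Rightarrow> int. True}"

definition fundamental_domain :: "'a::euclidean_space set \<Rightarrow> 'a set \<Rightarrow> 'a set \<Rightarrow> bool" where
  "fundamental_domain S J F \<longleftrightarrow>
     F \<in> sets borel \<and> F \<subseteq> S \<and> (\<forall>x\<in>S. \<exists>!v. v \<in> J \<and> x - v \<in> F)"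


section \<open>Rauzy measures\<close>

text \<open>
  The image of counting measure is the sum of unit masses. The prefix of length \<open>m\<close> is followed
  by the letter \<open>w ! m\<close>.
\<close>

definition word_measure ::
    "real ^ 'd::finite \<Rightarrow> real ^ 'd \<Rightarrow> 'd \<Rightarrow> 'd list \<Rightarrow> (real ^ 'd) measure" where
  "word_measure L R a w =
     distr (count_space {m. m < length w \<and> w ! m = a}) borel
       (\<lambda>m. proj L R (abelianise (take m w)))"

definition expected_word_measure ::
    "('d::finite \<Rightarrow> 'd list pmf) \<Rightarrow> real ^ 'd \<Rightarrow> real ^ 'd \<Rightarrow> 'd \<Rightarrow> nat \<Rightarrow> 'd list \<Rightarrow>
       (real ^ 'd) measure" where
  "expected_word_measure \<theta> L R a n v =
     measure_of UNIV (sets borel)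
       (\<lambda>A. \<integral>\<^sup>+ w. emeasure (word_measure L R a w) A \<partial>measure_pmf (subst_iter \<theta> n v))"

definition weak_limit :: "(nat \<Rightarrow> 'a::euclidean_space measure) \<Rightarrow> 'a measure \<Rightarrow> bool" where
  "weak_limit \<nu> \<mu> \<longleftrightarrow> sets \<mu> = sets borel \<and> finite_measure \<mu> \<and>
     (\<forall>f :: 'a \<Rightarrow> real. continuous_on UNIV f \<and> bounded (range f) \<longrightarrow>
        (\<lambda>n. integral\<^sup>L (\<nu> n) f) \<longlonglongrightarrow> integral\<^sup>L \<mu> f)"

text \<open>\<open>\<mu>\<close> is the Rauzy measure for the letter \<open>a\<close>, obtained by starting from the word \<open>v\<close>.\<close>

definition rauzy_measure ::
    "('d::finite \<Rightarrow> 'd list pmf) \<Rightarrow> real ^ 'd \<Rightarrow> real ^ 'd \<Rightarrow> 'd list \<Rightarrow> 'd \<Rightarrow>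
       (real ^ 'd) measure \<Rightarrow> bool" where
  "rauzy_measure \<theta> L R v a \<mu> \<longleftrightarrow>
     weak_limit
       (\<lambda>n. scale_measure (inverse (of_nat (iter_length \<theta> n v)))
              (expected_word_measure \<theta> L R a n v)) \<mu>"

end

theory Submission
  imports Defs
begin

(* leaves $ unambiguous for vector components *)
unbundle no fps_syntax

text \<open>
  Write \<open>H\<close> for the hyperplane, \<open>J\<close> for the lattice, \<open>\<pi>\<close> for the projection and \<open>\<alpha> = \<pi> e\<^sub>r\<close>. The
  abelianised prefix of length \<open>m\<close> of a word is an integer vector with coordinate sum \<open>m\<close>, so it
  projects to a point of \<open>m \<alpha> + J\<close> (\<open>prefix_lattice_coset\<close>). Hence a realisation can visit a set
  \<open>A\<close> at time \<open>m\<close> only if the orbit of the rotation by \<open>\<alpha>\<close> on the torus \<open>H / J\<close> is in the image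
  of \<open>A\<close> at time \<open>m\<close>, and each time accounts for at most one visit. An orbit of a minimal rotation
  is equidistributed, so among the first \<open>N\<close> times there are asymptotically at most
  \<open>N \<cdot> D \<cdot> Leb(A)\<close> visits. This bound is the same for all realisations, so it passes to the
  expectation and to the weak limit.

  The upper half of equidistribution is obtained by averaging (\<open>card_visits_le\<close>). If
  every point of \<open>H\<close> is \<open>\<epsilon>\<close>-close to \<open>k \<alpha> + J\<close> for some \<open>k \<le> K\<close>, then up to a delay of at most
  \<open>K\<close> steps and an error \<open>\<epsilon>\<close> the number of visits to \<open>A\<close> does not change when the orbit is
  translated by any \<open>t\<close>. Integrating over \<open>t\<close> in a fundamental domain \<open>F\<close>, each time contributes
  at most the measure of the \<open>\<epsilon>\<close>-neighbourhood of \<open>A\<close>, because the translates of \<open>F\<close> by \<open>J\<close> are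
  disjoint. With \<open>N \<rightarrow> \<infinity>\<close> and then \<open>\<epsilon> \<rightarrow> 0\<close> this gives \<open>\<mu>(C) \<le> D \<cdot> Leb(C)\<close> for compact \<open>C\<close>, and
  regularity together with the Radon--Nikodym theorem yields the bounded density
  (\<open>bounded_density_if_bounded_on_compacts\<close>).

  The number \<open>K\<close> exists because \<open>{k \<alpha>}\<close> is dense modulo \<open>J\<close>. In the basis \<open>\<pi>(e\<^sub>i - e\<^sub>r)\<close> of \<open>H\<close> the
  coordinates of \<open>\<alpha>\<close> are \<open>- R\<^sub>i\<close>, since \<open>\<pi> R = 0\<close> and the entries of \<open>R\<close> sum to one, so by
  Kronecker's theorem the density amounts to the linear independence of the entries of
  \<open>R\<close> over the integers. This is where the irreducibility of the characteristic polynomial enters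
  (\<open>eigenvector_entries_integrally_independent\<close>): up to a factor, the entries of \<open>R\<close> are
  polynomials in the eigenvalue of degree less than \<open>d\<close>, read off from the adjugate of \<open>X - M\<close>.
\<close>

section \<open>Adjugate matrices and characteristic polynomials\<close>

text \<open>
  The cofactors are written as determinants of \<open>A\<close> with a row replaced by a unit vector: this form
  makes the expansion of the determinant along a row an instance of its linearity in that row.
\<close>

definition adjugate :: "'a::comm_ring_1 ^ 'n ^ 'n \<Rightarrow> 'a ^ 'n ^ 'n" where
  "adjugate A = (\<chi> k i. det (\<chi> l. if l = i then axis k 1 else A $ l))"

text \<open>
  By linearity in row \<open>i\<close>, the \<open>(j, i)\<close> entry of the product is the determinant of \<open>A\<close> with row \<open>i\<close>
  replaced by row \<open>j\<close>. For \<open>i \<noteq> j\<close> this matrix has two equal rows.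
\<close>

lemma matrix_mul_adjugate:
  fixes A :: "'a::comm_ring_1 ^ 'n ^ 'n"
  shows "A ** adjugate A = mat (det A)"
proof -
  have "(A ** adjugate A) $ j $ i = (if j = i then det A else 0)" for i j
  proof -
    have "(A ** adjugate A) $ j $ i =
        (\<Sum>k\<in>UNIV. det (\<chi> l. if l = i then (A $ j $ k) *s axis k 1 else A $ l))"
      by (simp add: matrix_matrix_mult_def adjugate_def det_row_mul)
    also have "\<dots> = det (\<chi> l. if l = i then (\<Sum>k\<in>UNIV. (A $ j $ k) *s axis k 1) else A $ l)"
      using det_linear_row_sum[of "UNIV :: 'n set" i "\<lambda>l k. (A $ j $ k) *s axis k 1" "\<lambda>l. A $ l"]
      by simp
    also have "(\<Sum>k\<in>UNIV. (A $ j $ k) *s axis k (1::'a)) = A $ j"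
      by (simp add: vec_eq_iff axis_def if_distrib cong: if_cong)
    also have "det (\<chi> l. if l = i then A $ j else A $ l) = (if j = i then det A else 0)"
    proof (cases "j = i")
      case True
      then have "(\<chi> l. if l = i then A $ j else A $ l) = A"
        by (simp add: vec_eq_iff)
      then show ?thesis using True by simp
    next
      case False
      then have "det (\<chi> l. if l = i then A $ j else A $ l) = 0"
        by (intro det_identical_rows[of i j]) (auto simp: row_def)
      then show ?thesis using False by simp
    qed
    finally show ?thesis .
  qed
  then show ?thesis
    by (simp add: vec_eq_iff mat_def)
qed

lemma mat_mul_nth:
  fixes A :: "'a::comm_ring_1 ^ 'n ^ 'n"
  shows "(mat c ** A) $ i $ j = c * A $ i $ j" and "(A ** mat c) $ i $ j = c * A $ i $ j"
  by (simp_all add: matrix_matrix_mult_def mat_def if_distrib[of "\<lambda>x. x * _"] if_distrib[of "\<lambda>x. _ * x"] mult.commute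
      cong: if_cong)

text \<open>
  Transposition turns \<open>matrix_mul_adjugate\<close> into a left inverse up to the factor \<open>det A\<close>; in an
  integral domain a left and a right inverse up to the same non-zero factor agree.
\<close>

lemma adjugate_matrix_mul:
  fixes A :: "'a::idom ^ 'n ^ 'n"
  assumes "det A \<noteq> 0"
  shows "adjugate A ** A = mat (det A)"
proof -
  let ?B = "transpose (adjugate (transpose A))"
  have BA: "?B ** A = mat (det A)"
  proof -
    have "?B ** A = transpose (transpose A ** adjugate (transpose A))"
      by (simp add: matrix_transpose_mul)
    also have "\<dots> = mat (det A)"
      by (simp add: matrix_mul_adjugate)
    finally show ?thesis .
  qed
  have "?B ** mat (det A) = mat (det A) ** adjugate A"
    using BA matrix_mul_adjugate[of A] matrix_mul_assoc[of ?B A "adjugate A"] by simp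
  then have "det A * ?B $ i $ j = det A * adjugate A $ i $ j" for i j
    by (metis mat_mul_nth)
  then have "?B = adjugate A"
    using assms by (simp add: vec_eq_iff)
  then show ?thesis using BA by simp
qed

lemma prod_linear_polynomials:
  fixes f :: "'n \<Rightarrow> 'a::comm_semiring_1 poly"
  assumes "finite S" "\<And>i. i \<in> S \<Longrightarrow> degree (f i) \<le> 1"
  shows "degree (prod f S) \<le> card S" and "coeff (prod f S) (card S) = (\<Prod>i\<in>S. coeff (f i) 1)"
proof -
  have d: "degree (prod f S) \<le> card S" if "finite S" "\<And>i. i \<in> S \<Longrightarrow> degree (f i) \<le> 1" for S
    using degree_prod_sum_le[OF that(1), of f] sum_bounded_above[of S "degree \<circ> f" 1] that(2) by simp
  show "degree (prod f S) \<le> card S"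
    using assms by (rule d)
  show "coeff (prod f S) (card S) = (\<Prod>i\<in>S. coeff (f i) 1)"
    using assms
  proof (induction rule: finite_induct)
    case (insert x T)
    obtain a b where "f x = [:a, b:]"
      using insert.prems[of x] by (metis degree1_coeffs degree_0_id insertI1 le_Suc_eq le_zero_eq One_nat_def pCons_0_0 degree_eq_zeroE)
    then show ?case
      using insert d[of T] by (simp add: coeff_eq_0 coeff_pCons' split: nat.splits)
  qed simp
qed

definition char_matrix :: "int ^ 'd ^ 'd \<Rightarrow> int poly ^ 'd ^ 'd" where
  "char_matrix M = (\<chi> i j. (if i = j then [:0, 1:] else 0) - [:M $ i $ j:])"

lemma char_matrix_entry:
  "degree (char_matrix M $ i $ j) \<le> 1" "coeff (char_matrix M $ i $ j) 1 = (if i = j then 1 else 0)"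
  by (auto simp: char_matrix_def intro!: degree_diff_le)

text \<open>
  Taking the coefficient of degree \<open>d\<close> in the Leibniz formula keeps from each entry of \<open>X - M\<close> its
  coefficient of degree one, and these coefficients form the identity matrix.
\<close>

lemma degree_char_polynomial_ge:
  fixes M :: "int ^ 'd ^ 'd"
  shows "CARD('d) \<le> degree (char_polynomial M)"
proof -
  have "coeff (char_polynomial M) CARD('d) = det (mat 1 :: int ^ 'd ^ 'd)"
    unfolding char_polynomial_def char_matrix_def[symmetric] det_def coeff_sum
  proof (rule sum.cong[OF refl])
    fix p :: "'d \<Rightarrow> 'd"
    have "coeff (of_int (sign p) * (\<Prod>i\<in>UNIV. char_matrix M $ i $ p i)) CARD('d) =
        of_int (sign p) * (\<Prod>i\<in>UNIV. coeff (char_matrix M $ i $ p i) 1)"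
      using prod_linear_polynomials(2)[of UNIV "\<lambda>i. char_matrix M $ i $ p i"]
      by (simp add: of_int_poly char_matrix_entry del: One_nat_def)
    then show "coeff (of_int (sign p) * (\<Prod>i\<in>UNIV. char_matrix M $ i $ p i)) CARD('d) =
        of_int (sign p) * (\<Prod>i\<in>UNIV. (mat 1 :: int ^ 'd ^ 'd) $ i $ p i)"
      by (simp only: char_matrix_entry(2) mat_def vec_lambda_beta)
  qed
  then show ?thesis
    by (intro le_degree) simp
qed

lemma degree_adjugate_char_matrix:
  fixes M :: "int ^ 'd ^ 'd"
  shows "degree (adjugate (char_matrix M) $ k $ i) < CARD('d)"
proof -
  let ?B = "(\<chi> l. if l = i then axis k 1 else char_matrix M $ l) :: int poly ^ 'd ^ 'd"
  have "degree (of_int (sign p) * (\<Prod>l\<in>UNIV. ?B $ l $ p l)) \<le> CARD('d) - 1" for p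
  proof -
    have "(\<Prod>l\<in>UNIV. ?B $ l $ p l) = ?B $ i $ p i * (\<Prod>l\<in>UNIV - {i}. ?B $ l $ p l)"
      by (rule prod.remove) auto
    moreover have "degree (\<Prod>l\<in>UNIV - {i}. ?B $ l $ p l) \<le> card (UNIV - {i})"
      by (rule prod_linear_polynomials) (auto simp: char_matrix_entry simp del: One_nat_def)
    moreover have "degree (?B $ i $ p i) = 0"
      by (simp add: axis_def)
    ultimately have "degree (\<Prod>l\<in>UNIV. ?B $ l $ p l) \<le> CARD('d) - 1"
      using degree_mult_le[of "?B $ i $ p i" "\<Prod>l\<in>UNIV - {i}. ?B $ l $ p l"]
      by (simp only: card_Diff_singleton[OF UNIV_I])
    then show ?thesis
      using degree_smult_le[of "sign p" "\<Prod>l\<in>UNIV. ?B $ l $ p l"] by (simp add: of_int_poly)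
  qed
  then have "degree (det ?B) \<le> CARD('d) - 1"
    unfolding det_def by (intro degree_sum_le) (auto simp: finite_permutations)
  then show ?thesis
    using zero_less_card_finite[where 'a='d] unfolding adjugate_def by (simp del: zero_less_card_finite)
qed

section \<open>Rational independence of the Perron--Frobenius eigenvector\<close>

abbreviation eval_at :: "real \<Rightarrow> int poly \<Rightarrow> real" where
  "eval_at l p \<equiv> poly (map_poly of_int p) l"

lemma eval_at_add: "eval_at l (p + q) = eval_at l p + eval_at l q"
proof -
  have "map_poly of_int (p + q) = (map_poly of_int p + map_poly of_int q :: real poly)"
    by (rule poly_eqI) (simp add: coeff_map_poly)
  then show ?thesis by simp
qed

lemma eval_at_smult: "eval_at l (smult a p) = of_int a * eval_at l p"
  by (simp add: map_poly_smult)

lemma eval_at_mult: "eval_at l (p * q) = eval_at l p * eval_at l q"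
proof (induction p)
  case (pCons a p)
  then show ?case
    by (simp add: eval_at_add eval_at_smult map_poly_pCons algebra_simps)
qed simp

lemma eval_at_sum: "eval_at l (sum f S) = (\<Sum>x\<in>S. eval_at l (f x))"
  by (induction S rule: infinite_finite_induct) (simp_all add: eval_at_add)

text \<open>
  An irreducible polynomial has minimal degree among the integer polynomials that vanish at one of
  its roots. Let \<open>m\<close> be of minimal degree. Pseudo-division shows that \<open>m\<close> divides a non-zero
  integer multiple of \<open>p\<close>; as \<open>p\<close> is a prime element, it divides \<open>m\<close> or the cofactor, and in the
  latter case \<open>m\<close> would be a non-zero constant with a root.
\<close>

lemma irreducible_root_degree_minimal:
  fixes p q :: "int poly"
  assumes irr: "irreducible p" and p: "eval_at l p = 0" and q: "eval_at l q = 0" "q \<noteq> 0"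
  shows "degree p \<le> degree q"
proof -
  define m where "m = arg_min degree (\<lambda>m. eval_at l m = 0 \<and> m \<noteq> 0)"
  have m: "eval_at l m = 0" "m \<noteq> 0" and min: "\<And>s. eval_at l s = 0 \<Longrightarrow> s \<noteq> 0 \<Longrightarrow> degree m \<le> degree s"
    using arg_min_nat_lemma[of "\<lambda>m. eval_at l m = 0 \<and> m \<noteq> 0" q degree] q
    unfolding m_def by auto
  from pseudo_mod[OF m(2), of p] obtain a s
    where a: "a \<noteq> 0" "smult a p = m * s + pseudo_mod p m"
      and deg: "pseudo_mod p m = 0 \<or> degree (pseudo_mod p m) < degree m" by blast
  have "eval_at l (pseudo_mod p m) = 0"
    using arg_cong[OF a(2), of "eval_at l"] p m(1) by (simp add: eval_at_add eval_at_smult eval_at_mult)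
  with min deg have "pseudo_mod p m = 0"
    by (meson linorder_not_le)
  with a have ms: "smult a p = m * s" by simp
  have p0: "p \<noteq> 0" using irr by auto
  with a ms have s0: "s \<noteq> 0" by auto
  have dsum: "degree p = degree m + degree s"
    using arg_cong[OF ms, of degree] a(1) m(2) s0 by (simp add: degree_mult_eq)
  have "prime_elem p"
    using irr by (rule irreducible_imp_prime_elem_gcd)
  moreover have "p dvd m * s"
    unfolding ms[symmetric] by (simp add: dvd_smult)
  ultimately consider "p dvd m" | "p dvd s"
    by (auto simp: prime_elem_dvd_mult_iff)
  then have "degree p \<le> degree m"
  proof cases
    case 2
    then have "degree m = 0"
      using dvd_imp_degree_le[of p s] s0 dsum by simp
    then obtain c where "m = [:c:]" by (rule degree_eq_zeroE)
    with m show ?thesis by (simp add: map_poly_pCons)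
  qed (use m in \<open>auto intro: dvd_imp_degree_le\<close>)
  with min[OF q] show ?thesis by simp
qed

lemma of_int_matrix_mul:
  "(of_int_matrix (M ** N) :: real ^ 'd ^ 'd) = of_int_matrix M ** of_int_matrix N"
  by (simp add: of_int_matrix_def matrix_matrix_mult_def vec_eq_iff)

lemma of_int_matrix_power_eigenvector:
  fixes y :: "real ^ 'd"
  assumes "of_int_matrix M *v y = l *s y"
  shows "of_int_matrix (((**) M ^^ k) (mat 1)) *v y = l ^ k *s y"
proof (induction k)
  case 0
  have "of_int_matrix (mat 1) = (mat 1 :: real ^ 'd ^ 'd)"
    by (simp add: of_int_matrix_def mat_def vec_eq_iff)
  then show ?case by simp
next
  case (Suc k)
  have "of_int_matrix (((**) M ^^ Suc k) (mat 1)) *v y =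
      of_int_matrix M *v (of_int_matrix (((**) M ^^ k) (mat 1)) *v y)"
    by (simp add: of_int_matrix_mul matrix_vector_mul_assoc)
  also have "\<dots> = l ^ k *s (of_int_matrix M *v y)"
    unfolding Suc.IH by (rule vector_scalar_commute)
  finally show ?case
    by (simp add: assms vector_smult_assoc mult.commute)
qed

text \<open>
  The uniqueness part of the Perron--Frobenius theorem. Subtract the largest multiple of \<open>R\<close> from
  \<open>y\<close> that leaves a non-negative vector \<open>z\<close>. Then \<open>z\<close> is an eigenvector with a vanishing entry,
  whereas a positive matrix maps a non-zero non-negative vector to a positive one.
\<close>

lemma positive_matrix_eigenvector_unique:
  fixes P :: "real ^ 'd ^ 'd" and R y :: "real ^ 'd"
  assumes P: "\<And>i j. 0 < P $ i $ j" and R: "\<And>i. 0 < R $ i"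
    and PR: "P *v R = c *s R" and Py: "P *v y = c *s y"
  shows "\<exists>t. y = t *s R"
proof -
  define t where "t = Min (range (\<lambda>i. y $ i / R $ i))"
  define z where "z = y - t *s R"
  have "t \<in> range (\<lambda>i. y $ i / R $ i)"
    unfolding t_def by (rule Min_in) auto
  then obtain i where "t = y $ i / R $ i" by blast
  then have zi: "z $ i = 0"
    using R[of i] by (simp add: z_def)
  have z: "0 \<le> z $ j" for j
  proof -
    have "t \<le> y $ j / R $ j" unfolding t_def by (rule Min_le) auto
    then show ?thesis using R[of j] by (simp add: z_def field_simps)
  qed
  have "P *v z = c *s z"
    by (simp add: z_def matrix_vector_mult_diff_distrib vector_scalar_commute PR Py
        vector_smult_assoc mult.commute vector_ssub_ldistrib)
  then have "(\<Sum>j\<in>UNIV. P $ i $ j * z $ j) = 0"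
    using zi by (simp add: vec_eq_iff matrix_vector_mult_def)
  moreover have "0 \<le> P $ i $ j * z $ j" for j
    using P[of i j] z[of j] by simp
  ultimately have "\<forall>j\<in>UNIV. P $ i $ j * z $ j = 0"
    by (subst (asm) sum_nonneg_eq_0_iff) auto
  then have "z = 0"
    using P[of i] by (simp add: vec_eq_iff) (metis less_irrefl)
  then show ?thesis
    by (auto simp: z_def)
qed

lemma eval_at_char_matrix:
  "eval_at l (char_matrix M $ i $ j) = (if i = j then l else 0) - of_int (M $ i $ j)"
proof -
  have "char_matrix M $ i $ j = [:- (M $ i $ j), if i = j then 1 else 0:]"
    by (simp add: char_matrix_def)
  then show ?thesis by (simp add: map_poly_pCons)
qed

text \<open>
  Let \<open>B\<close> be the adjugate of \<open>X - M\<close>, with polynomial entries of degree less than \<open>d\<close>. At \<open>X = l\<close>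
  the columns of \<open>B\<close> lie in the eigenspace of \<open>l\<close>, so they are multiples of \<open>R\<close> and orthogonal to
  \<open>c\<close>. Hence the entries of the row vector \<open>c B\<close> vanish at \<open>l\<close>, and having degree less than that of
  the irreducible characteristic polynomial \<open>p\<close> they vanish identically. Multiplication by
  \<open>X - M\<close> gives \<open>p c = 0\<close>.
\<close>

lemma eigenvector_entries_integrally_independent:
  fixes M :: "int ^ 'd ^ 'd" and R :: "real ^ 'd" and c :: "'d \<Rightarrow> int"
  assumes prim: "primitive_matrix M" and irr: "irreducible (char_polynomial M)"
    and R: "\<And>i. 0 < R $ i" and eig: "of_int_matrix M *v R = l *s R"
    and rel: "(\<Sum>i\<in>UNIV. of_int (c i) * R $ i) = 0"
  shows "c i = 0"
proof -
  let ?A = "char_matrix M" and ?B = "adjugate (char_matrix M)" and ?p = "char_polynomial M"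
  have det: "det ?A = ?p"
    by (simp add: char_matrix_def char_polynomial_def)
  have p0: "?p \<noteq> 0" using irr by auto
  have AB: "?A ** ?B = mat ?p"
    using matrix_mul_adjugate[of ?A] by (simp add: det)
  have BA: "?B ** ?A = mat ?p"
    using adjugate_matrix_mul[of ?A] p0 by (simp add: det)
  have A_kernel: "(\<Sum>k\<in>UNIV. eval_at l (?A $ i $ k) * y $ k) = l * y $ i - (of_int_matrix M *v y) $ i"
    for y :: "real ^ 'd" and i
    by (simp add: eval_at_char_matrix left_diff_distrib sum_subtractf matrix_vector_mult_def of_int_matrix_def
        if_distrib[of "\<lambda>x. x * _"] cong: if_cong)
  have root: "eval_at l ?p = 0"
  proof -
    fix i :: 'd
    have "eval_at l ?p * R $ i = (\<Sum>j\<in>UNIV. eval_at l ((?B ** ?A) $ i $ j) * R $ j)"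
      unfolding BA by (simp add: mat_def if_distrib[of "\<lambda>p. eval_at l p * _"] cong: if_cong)
    also have "\<dots> = (\<Sum>j\<in>UNIV. \<Sum>k\<in>UNIV. eval_at l (?B $ i $ k) * (eval_at l (?A $ k $ j) * R $ j))"
      by (simp add: matrix_matrix_mult_def eval_at_sum eval_at_mult sum_distrib_right mult.assoc)
    also have "\<dots> = (\<Sum>k\<in>UNIV. eval_at l (?B $ i $ k) * (\<Sum>j\<in>UNIV. eval_at l (?A $ k $ j) * R $ j))"
      by (subst sum.swap) (simp add: sum_distrib_left)
    also have "\<dots> = 0"
      by (simp add: A_kernel eig)
    finally show ?thesis using R[of i] by simp
  qed
  have column: "\<exists>t. \<forall>k. eval_at l (?B $ k $ j) = t * R $ k" for j
  proof -
    define y where "y = (\<chi> k. eval_at l (?B $ k $ j))"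
    have "l * y $ i - (of_int_matrix M *v y) $ i = eval_at l ((?A ** ?B) $ i $ j)" for i
      unfolding A_kernel[symmetric]
      by (simp add: matrix_matrix_mult_def eval_at_sum eval_at_mult y_def)
    then have "l * y $ i - (of_int_matrix M *v y) $ i = 0" for i
      by (cases "i = j") (simp_all add: AB mat_def root)
    then have "of_int_matrix M *v y = l *s y"
      by (simp add: vec_eq_iff)
    note ey = of_int_matrix_power_eigenvector[OF this] and eR = of_int_matrix_power_eigenvector[OF eig]
    from prim obtain k where "\<forall>i j. 0 < (((**) M ^^ k) (mat 1)) $ i $ j"
      by (auto simp: primitive_matrix_def)
    then have "\<exists>t. y = t *s R"
      by (intro positive_matrix_eigenvector_unique[OF _ R eR[of k] ey[of k]]) (simp add: of_int_matrix_def)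
    then show ?thesis by (auto simp: vec_eq_iff y_def)
  qed
  have zero: "(\<Sum>k\<in>UNIV. smult (c k) (?B $ k $ j)) = 0" (is "?q = 0") for j
  proof (rule ccontr)
    assume nz: "?q \<noteq> 0"
    obtain t where t: "\<And>k. eval_at l (?B $ k $ j) = t * R $ k" using column by blast
    have "eval_at l ?q = t * (\<Sum>k\<in>UNIV. of_int (c k) * R $ k)"
      by (simp add: eval_at_sum eval_at_smult t sum_distrib_left mult_ac)
    then have "eval_at l ?q = 0" using rel by simp
    from irreducible_root_degree_minimal[OF irr root this nz] degree_char_polynomial_ge[of M]
    have "CARD('d) \<le> degree ?q" by linarith
    moreover have "degree ?q < CARD('d)"
      using degree_adjugate_char_matrix[of M] zero_less_card_finite[where 'a='d]
      by (intro degree_sum_less) (auto intro: le_less_trans[OF degree_smult_le])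
    ultimately show False by simp
  qed
  have "smult (c i) ?p = (\<Sum>k\<in>UNIV. smult (c k) ((?B ** ?A) $ k $ i))"
    unfolding BA by (simp add: mat_def if_distrib[of "smult _"] cong: if_cong)
  also have "\<dots> = (\<Sum>j\<in>UNIV. (\<Sum>k\<in>UNIV. smult (c k) (?B $ k $ j)) * ?A $ j $ i)"
  proof -
    have smult_sum: "smult a (sum f UNIV) = (\<Sum>x\<in>UNIV. smult a (f x))" for a :: int and f :: "'d \<Rightarrow> int poly"
      by (simp add: poly_eq_iff coeff_sum sum_distrib_left)
    show ?thesis
      by (simp add: matrix_matrix_mult_def smult_sum sum_distrib_right) (rule sum.swap)
  qed
  also have "\<dots> = 0" by (simp add: zero)
  finally show ?thesis using p0 by simp
qed

section \<open>Minimality of the rotation on the torus\<close>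

text \<open>
  Kronecker's theorem for the family \<open>\<beta>\<close> and \<open>1\<close>, freed from the enumeration of the indices. The
  family is transported to an initial segment of the natural numbers with \<open>1\<close> at the last place.
\<close>

lemma kronecker_approximation_finite:
  fixes \<beta> \<tau> :: "'i \<Rightarrow> real"
  assumes fin: "finite I" and eps: "0 < \<epsilon>"
    and indep: "\<And>(c :: 'i \<Rightarrow> int) (c0 :: int) i.
      (\<Sum>i\<in>I. of_int (c i) * \<beta> i) + of_int c0 = 0 \<Longrightarrow> i \<in> I \<Longrightarrow> c i = 0"
  shows "\<exists>(k :: int) (m :: 'i \<Rightarrow> int). \<forall>i\<in>I. \<bar>of_int k * \<beta> i - of_int (m i) - \<tau> i\<bar> < \<epsilon>"
proof -
  interpret Modules.module "(\<lambda>r. (*) (real_of_int r))"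
    by (simp add: Modules.module.intro distrib_left mult.commute)
  obtain e where e: "bij_betw e {..<card I} I"
    using ex_bij_betw_nat_finite[OF fin] by (auto simp: atLeast0LessThan)
  define n where "n = card I"
  define g where "g = inv_into {..<n} e"
  have eI: "e i \<in> I" if "i < n" for i
    using e that by (auto simp: bij_betw_def n_def)
  have ge: "g (e i) = i" if "i < n" for i
    using e that by (auto simp: bij_betw_def n_def g_def intro: inv_into_f_f)
  have gI: "g i < n" "e (g i) = i" if "i \<in> I" for i
    using e that bij_betw_inv_into_right[OF e that] inv_into_into[of i e "{..<n}"]
    by (auto simp: bij_betw_def n_def g_def)
  define \<theta> where "\<theta> i = (if i < n then \<beta> (e i) else 1)" for i
  have indep': "\<forall>i<n. c i = 0" if "(\<Sum>i\<le>n. of_int (c i) * \<theta> i) = 0" for c :: "nat \<Rightarrow> int"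
  proof -
    have "(\<Sum>i\<in>I. of_int (c (g i)) * \<beta> i) = (\<Sum>i<n. of_int (c (g (e i))) * \<beta> (e i))"
      using e by (subst sum.reindex_bij_betw[symmetric, of e "{..<n}" I]) (auto simp: n_def)
    also have "\<dots> = (\<Sum>i<n. of_int (c i) * \<theta> i)"
      by (intro sum.cong) (auto simp: ge \<theta>_def)
    finally have "(\<Sum>i\<in>I. of_int (c (g i)) * \<beta> i) + of_int (c n) = 0"
      using that by (simp add: lessThan_Suc_atMost[symmetric] \<theta>_def)
    from indep[OF this] show ?thesis
      using eI ge by metis
  qed
  have inj: "inj_on \<theta> {..n}"
  proof (rule inj_onI, rule ccontr)
    fix i j assume ij: "i \<in> {..n}" "j \<in> {..n}" "\<theta> i = \<theta> j" "i \<noteq> j"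
    define c :: "nat \<Rightarrow> int" where "c k = (if k = i then 1 else if k = j then -1 else 0)" for k
    have "(\<Sum>k\<le>n. of_int (c k) * \<theta> k) = (\<Sum>k\<in>{i, j}. of_int (c k) * \<theta> k)"
      using ij by (intro sum.mono_neutral_right) (auto simp: c_def)
    also have "\<dots> = 0"
      using ij by (simp add: c_def)
    finally have "\<forall>k<n. c k = 0" by (rule indep')
    then show False
      using ij by (metis atMost_iff c_def le_neq_implies_less one_neq_zero neg_equal_0_iff_equal)
  qed
  have "independent (\<theta> ` {..n})"
  proof
    assume "dependent (\<theta> ` {..n})"
    then obtain f i0 where nz: "f (\<theta> i0) \<noteq> 0" "i0 \<in> {..n}"
      and f: "(\<Sum>x\<in>\<theta> ` {..n}. real_of_int (f x) * x) = 0"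
      by (subst (asm) dependent_finite) auto
    from f have s: "(\<Sum>i\<le>n. of_int (f (\<theta> i)) * \<theta> i) = 0"
      using inj by (simp add: sum.reindex)
    then have z: "\<forall>i<n. f (\<theta> i) = 0" by (rule indep')
    with s have "f (\<theta> n) = 0"
      by (simp add: lessThan_Suc_atMost[symmetric] \<theta>_def)
    with z nz show False
      by (auto simp: le_less)
  qed
  then obtain k m where km: "\<And>i. i < n \<Longrightarrow> \<bar>of_int k * \<theta> i - of_int (m i) - \<tau> (e i)\<bar> < \<epsilon>"
    using Kronecker_thm_2[of \<theta> n \<epsilon> "\<lambda>i. \<tau> (e i)"] inj eps by (auto simp: \<theta>_def)
  have "\<bar>of_int k * \<beta> i - of_int (m (g i)) - \<tau> i\<bar> < \<epsilon>" if "i \<in> I" for i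
    using km[OF gI(1)[OF that]] gI[OF that] by (simp add: \<theta>_def)
  then show ?thesis by (intro exI[of _ k] exI[of _ "\<lambda>i. m (g i)"]) auto
qed

lemma linear_proj: "linear (proj L R)"
  by (rule linearI) (simp_all add: proj_def inner_add_right scaleR_add_left algebra_simps)

lemma proj_in_hyperplane: "L \<bullet> R = 1 \<Longrightarrow> proj L R x \<in> hyperplane L"
  by (simp add: proj_def hyperplane_def inner_diff_right)

lemma proj_hyperplane_id: "x \<in> hyperplane L \<Longrightarrow> proj L R x = x"
  by (simp add: proj_def hyperplane_def)

lemma hyperplane_subspace: "subspace (hyperplane L)"
  unfolding hyperplane_def by (rule subspace_hyperplane)

text \<open>
  Replacing each \<open>e\<^sub>i\<close> by \<open>(e\<^sub>i - e\<^sub>r) + e\<^sub>r\<close> separates the lattice directions from the multiples of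
  \<open>\<pi> e\<^sub>r\<close>, which are counted by the coordinate sum.
\<close>

lemma proj_lattice_coordinates:
  fixes x :: "real ^ 'd"
  shows "proj L R x = (\<Sum>i\<in>UNIV - {r}. x $ i *\<^sub>R proj L R (axis i 1 - axis r 1))
           + (\<Sum>i\<in>UNIV. x $ i) *\<^sub>R proj L R (axis r 1)"
proof -
  let ?p = "proj L R"
  have "?p x = ?p (\<Sum>i\<in>UNIV. x $ i *\<^sub>R axis i 1)"
    by (rule arg_cong[of _ _ ?p]) (simp add: vec_eq_iff axis_def if_distrib[of "\<lambda>y. _ * y"] cong: if_cong)
  also have "\<dots> = (\<Sum>i\<in>UNIV. x $ i *\<^sub>R ?p (axis i 1))"
    by (simp add: linear_sum[OF linear_proj] linear_scale[OF linear_proj])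
  also have "\<dots> = (\<Sum>i\<in>UNIV. x $ i *\<^sub>R ?p (axis i 1 - axis r 1) + x $ i *\<^sub>R ?p (axis r 1))"
    by (simp add: linear_diff[OF linear_proj] algebra_simps)
  also have "\<dots> = (\<Sum>i\<in>UNIV. x $ i *\<^sub>R ?p (axis i 1 - axis r 1)) + (\<Sum>i\<in>UNIV. x $ i) *\<^sub>R ?p (axis r 1)"
    by (simp add: sum.distrib scaleR_sum_left)
  also have "(\<Sum>i\<in>UNIV. x $ i *\<^sub>R ?p (axis i 1 - axis r 1)) =
      (\<Sum>i\<in>UNIV - {r}. x $ i *\<^sub>R ?p (axis i 1 - axis r 1))"
    by (rule sum.mono_neutral_right) (auto simp: linear_0[OF linear_proj])
  finally show ?thesis .
qed

lemma rauzy_lattice_subset: "L \<bullet> R = 1 \<Longrightarrow> rauzy_lattice L R r \<subseteq> hyperplane L"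
  unfolding rauzy_lattice_def
  by (auto intro!: subspace_sum subspace_scale hyperplane_subspace proj_in_hyperplane)

lemma rauzy_latticeI:
  "(\<Sum>i\<in>UNIV - {r}. of_int (c i) *\<^sub>R proj L R (axis i 1 - axis r 1)) \<in> rauzy_lattice L R r"
  unfolding rauzy_lattice_def by blast

lemma rauzy_lattice_group:
  shows "0 \<in> rauzy_lattice L R r"
    and "x \<in> rauzy_lattice L R r \<Longrightarrow> y \<in> rauzy_lattice L R r \<Longrightarrow> x + y \<in> rauzy_lattice L R r"
    and "x \<in> rauzy_lattice L R r \<Longrightarrow> - x \<in> rauzy_lattice L R r"
proof -
  show "0 \<in> rauzy_lattice L R r"
    using rauzy_latticeI[where c = "\<lambda>_. 0" and L = L and R = R and r = r] by simp
  show "x + y \<in> rauzy_lattice L R r" if xy: "x \<in> rauzy_lattice L R r" "y \<in> rauzy_lattice L R r"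
  proof -
    from xy obtain c c' where
      "x = (\<Sum>i\<in>UNIV - {r}. of_int (c i) *\<^sub>R proj L R (axis i 1 - axis r 1))"
      "y = (\<Sum>i\<in>UNIV - {r}. of_int (c' i) *\<^sub>R proj L R (axis i 1 - axis r 1))"
      unfolding rauzy_lattice_def by blast
    then show ?thesis
      using rauzy_latticeI[where c = "\<lambda>i. c i + c' i" and L = L and R = R and r = r]
      by (simp add: scaleR_add_left sum.distrib)
  qed
  show "- x \<in> rauzy_lattice L R r" if x: "x \<in> rauzy_lattice L R r"
  proof -
    from x obtain c where
      "x = (\<Sum>i\<in>UNIV - {r}. of_int (c i) *\<^sub>R proj L R (axis i 1 - axis r 1))"
      unfolding rauzy_lattice_def by blast
    then show ?thesis
      using rauzy_latticeI[where c = "\<lambda>i. - c i" and L = L and R = R and r = r]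
      by (simp add: sum_negf)
  qed
qed

lemma countable_rauzy_lattice: "countable (rauzy_lattice L R r)"
proof -
  have "rauzy_lattice L R r =
      range (\<lambda>c :: 'a \<Rightarrow> int. \<Sum>i\<in>UNIV - {r}. of_int (c i) *\<^sub>R proj L R (axis i 1 - axis r 1))"
    by (auto simp: rauzy_lattice_def)
  then show ?thesis by simp
qed

lemma proj_lattice_coset:
  fixes x :: "real ^ 'd"
  assumes "\<And>i. x $ i = of_int (c i)"
  shows "proj L R x - (\<Sum>i\<in>UNIV. x $ i) *\<^sub>R proj L R (axis r 1) \<in> rauzy_lattice L R r"
  unfolding proj_lattice_coordinates[of L R x r] using rauzy_latticeI[of c] by (simp add: assms)

text \<open>
  The second equation gives the coordinates of the rotation vector \<open>\<pi> e\<^sub>r\<close>: apply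
  \<open>proj_lattice_coordinates\<close> to \<open>R\<close>, which projects to \<open>0\<close> and has coordinate sum \<open>1\<close>.
\<close>

lemma hyperplane_coordinates:
  fixes L R t :: "real ^ 'd"
  assumes LR: "L \<bullet> R = 1" and R1: "(\<Sum>i\<in>UNIV. R $ i) = 1" and t: "t \<in> hyperplane L"
  obtains x where "t = (\<Sum>i\<in>UNIV - {r}. x i *\<^sub>R proj L R (axis i 1 - axis r 1))"
    and "proj L R (axis r 1) = (\<Sum>i\<in>UNIV - {r}. (- R $ i) *\<^sub>R proj L R (axis i 1 - axis r 1))"
proof -
  let ?b = "\<lambda>i. proj L R (axis i 1 - axis r 1)"
  have "proj L R R = 0" using LR by (simp add: proj_def)
  then have a: "proj L R (axis r 1) = (\<Sum>i\<in>UNIV - {r}. (- R $ i) *\<^sub>R ?b i)"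
    using proj_lattice_coordinates[of L R R r] R1
    by (simp add: sum_negf add.commute eq_neg_iff_add_eq_0)
  have "t = (\<Sum>i\<in>UNIV - {r}. t $ i *\<^sub>R ?b i) + (\<Sum>i\<in>UNIV. t $ i) *\<^sub>R proj L R (axis r 1)"
    using proj_lattice_coordinates[of L R t r] by (simp add: proj_hyperplane_id[OF t])
  also have "\<dots> = (\<Sum>i\<in>UNIV - {r}. (t $ i - (\<Sum>i\<in>UNIV. t $ i) * R $ i) *\<^sub>R ?b i)"
    unfolding a by (simp add: scaleR_sum_right sum.distrib[symmetric] algebra_simps)
  finally show ?thesis using a by (rule that)
qed

text \<open>
  In lattice coordinates this is Kronecker's theorem for the numbers \<open>R\<^sub>i\<close>, \<open>i \<noteq> r\<close>. A relation
  between these and \<open>1\<close> becomes a relation between all entries of \<open>R\<close> upon writing \<open>1\<close> as their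
  sum.
\<close>

lemma lattice_orbit_dense:
  fixes L R t :: "real ^ 'd"
  assumes LR: "L \<bullet> R = 1" and R1: "(\<Sum>i\<in>UNIV. R $ i) = 1"
    and indep: "\<forall>c :: 'd \<Rightarrow> int. (\<Sum>i\<in>UNIV. of_int (c i) * R $ i) = 0 \<longrightarrow> (\<forall>i. c i = 0)"
    and t: "t \<in> hyperplane L" and eps: "0 < \<epsilon>"
  shows "\<exists>k :: int. \<exists>j\<in>rauzy_lattice L R r. norm (of_int k *\<^sub>R proj L R (axis r 1) + j - t) < \<epsilon>"
proof -
  let ?b = "\<lambda>i. proj L R (axis i 1 - axis r 1)"
  obtain x where x: "t = (\<Sum>i\<in>UNIV - {r}. x i *\<^sub>R ?b i)"
    and a: "proj L R (axis r 1) = (\<Sum>i\<in>UNIV - {r}. (- R $ i) *\<^sub>R ?b i)"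
    using hyperplane_coordinates[OF LR R1 t] by blast
  define s where "s = 1 + (\<Sum>i\<in>UNIV - {r}. norm (?b i))"
  have s: "0 < s" by (simp add: s_def add_pos_nonneg sum_nonneg)
  have "\<exists>(k :: int) (m :: 'd \<Rightarrow> int). \<forall>i\<in>UNIV - {r}. \<bar>of_int k * R $ i - of_int (m i) - (- x i)\<bar> < \<epsilon> / s"
  proof (rule kronecker_approximation_finite)
    fix c :: "'d \<Rightarrow> int" and c0 i
    assume rel: "(\<Sum>i\<in>UNIV - {r}. of_int (c i) * R $ i) + of_int c0 = 0" and i: "i \<in> UNIV - {r}"
    define d where "d i = (if i = r then c0 else c i + c0)" for i
    have "(\<Sum>i\<in>UNIV. of_int (d i) * R $ i) = of_int c0 * R $ r + (\<Sum>i\<in>UNIV - {r}. of_int (d i) * R $ i)"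
      by (subst sum.remove[of _ r]) (simp_all add: d_def)
    also have "(\<Sum>i\<in>UNIV - {r}. of_int (d i) * R $ i) =
        (\<Sum>i\<in>UNIV - {r}. of_int (c i) * R $ i) + of_int c0 * (\<Sum>i\<in>UNIV - {r}. R $ i)"
      by (simp add: d_def sum.distrib[symmetric] sum_distrib_left algebra_simps)
    also have "(\<Sum>i\<in>UNIV - {r}. R $ i) = 1 - R $ r"
      using R1 sum.remove[of UNIV r "\<lambda>i. R $ i"] by simp
    finally have "(\<Sum>i\<in>UNIV. of_int (d i) * R $ i) = 0"
      using rel by (simp add: algebra_simps)
    with indep[THEN spec, of d] have "d r = 0" "d i = 0" by simp_all
    with i show "c i = 0" by (simp add: d_def)
  qed (use eps s in auto)
  then obtain k :: int and m :: "'d \<Rightarrow> int"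
    where km: "\<And>i. i \<in> UNIV - {r} \<Longrightarrow> \<bar>of_int k * R $ i - of_int (m i) + x i\<bar> < \<epsilon> / s"
    by auto
  let ?j = "\<Sum>i\<in>UNIV - {r}. of_int (m i) *\<^sub>R ?b i"
  have "of_int k *\<^sub>R proj L R (axis r 1) + ?j - t =
      (\<Sum>i\<in>UNIV - {r}. (- (of_int k * R $ i - of_int (m i) + x i)) *\<^sub>R ?b i)"
    unfolding x a by (simp add: scaleR_sum_right sum.distrib[symmetric] sum_subtractf[symmetric] algebra_simps)
  also have "norm \<dots> \<le> (\<Sum>i\<in>UNIV - {r}. \<epsilon> / s * norm (?b i))"
  proof (rule sum_norm_le)
    fix i assume "i \<in> UNIV - {r}"
    from less_imp_le[OF km[OF this]]
    show "norm ((- (of_int k * R $ i - of_int (m i) + x i)) *\<^sub>R ?b i) \<le> \<epsilon> / s * norm (?b i)"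
      by (simp only: norm_scaleR abs_minus_cancel mult_right_mono norm_ge_zero)
  qed
  also have "\<dots> < \<epsilon>"
  proof -
    have "(\<Sum>i\<in>UNIV - {r}. \<epsilon> / s * norm (?b i)) = \<epsilon> / s * (s - 1)"
      by (simp add: sum_distrib_left s_def)
    also have "\<dots> < \<epsilon>" using s eps by (simp add: field_simps)
    finally show ?thesis .
  qed
  finally show ?thesis using rauzy_latticeI[of m] by blast
qed

text \<open>
  The torus \<open>H / J\<close> is compact, so boundedly many steps of the rotation suffice. A bound \<open>K\<close> for
  steps in both directions becomes the bound \<open>2 K\<close> for non-negative steps when the target is first
  moved back by \<open>K\<close> steps.
\<close>

lemma lattice_orbit_uniformly_dense:
  fixes L R :: "real ^ 'd"
  assumes LR: "L \<bullet> R = 1" and R1: "(\<Sum>i\<in>UNIV. R $ i) = 1"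
    and indep: "\<forall>c :: 'd \<Rightarrow> int. (\<Sum>i\<in>UNIV. of_int (c i) * R $ i) = 0 \<longrightarrow> (\<forall>i. c i = 0)"
    and eps: "0 < \<epsilon>"
  obtains K :: nat where "\<And>t. t \<in> hyperplane L \<Longrightarrow>
     \<exists>k\<le>K. \<exists>j\<in>rauzy_lattice L R r. norm (of_nat k *\<^sub>R proj L R (axis r 1) + j - t) < \<epsilon>"
proof -
  let ?a = "proj L R (axis r 1)" and ?H = "hyperplane L" and ?J = "rauzy_lattice L R r"
  let ?b = "\<lambda>i. proj L R (axis i 1 - axis r 1)"
  \<comment> \<open>A compact set containing the unit parallelepiped of the lattice basis.\<close>
  define P where "P = ?H \<inter> cball 0 (\<Sum>i\<in>UNIV - {r}. norm (?b i))"
  have cP: "compact P"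
    unfolding P_def by (intro closed_Int_compact closed_subspace hyperplane_subspace) simp
  have "P \<subseteq> (\<Union>p\<in>UNIV \<times> ?J. ball (of_int (fst p) *\<^sub>R ?a + snd p) \<epsilon>)"
  proof
    fix t assume "t \<in> P"
    then have "t \<in> ?H" by (simp add: P_def)
    from lattice_orbit_dense[OF LR R1 indep this eps] obtain k j
      where "j \<in> ?J" "norm (of_int k *\<^sub>R ?a + j - t) < \<epsilon>" by blast
    then show "t \<in> (\<Union>p\<in>UNIV \<times> ?J. ball (of_int (fst p) *\<^sub>R ?a + snd p) \<epsilon>)"
      by (intro UN_I[of "(k, j)"]) (auto simp: dist_norm)
  qed
  then obtain T where T: "T \<subseteq> UNIV \<times> ?J" "finite T" "P \<subseteq> (\<Union>p\<in>T. ball (of_int (fst p) *\<^sub>R ?a + snd p) \<epsilon>)"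
    by (rule compactE_image[OF cP open_ball])
  define K where "K = (\<Sum>p\<in>T. nat \<bar>fst p\<bar>)"
  have K: "nat \<bar>fst p\<bar> \<le> K" if "p \<in> T" for p
    unfolding K_def using T(2) that by (intro member_le_sum) auto
  have "\<exists>k\<le>2 * K. \<exists>j\<in>?J. norm (of_nat k *\<^sub>R ?a + j - t) < \<epsilon>" if "t \<in> ?H" for t
  proof -
    have t': "t - of_nat K *\<^sub>R ?a \<in> ?H"
      using that by (intro subspace_diff subspace_scale hyperplane_subspace proj_in_hyperplane LR)
    obtain x where x: "t - of_nat K *\<^sub>R ?a = (\<Sum>i\<in>UNIV - {r}. x i *\<^sub>R ?b i)"
      using hyperplane_coordinates[OF LR R1 t'] by blast
    define j where "j = (\<Sum>i\<in>UNIV - {r}. of_int \<lfloor>x i\<rfloor> *\<^sub>R ?b i)"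
    have j: "j \<in> ?J" unfolding j_def by (rule rauzy_latticeI)
    have "t - of_nat K *\<^sub>R ?a - j = (\<Sum>i\<in>UNIV - {r}. frac (x i) *\<^sub>R ?b i)"
      unfolding x j_def by (simp add: frac_def sum_subtractf[symmetric] algebra_simps)
    moreover have "norm \<dots> \<le> (\<Sum>i\<in>UNIV - {r}. norm (?b i))"
      by (intro sum_norm_le) (simp add: mult_left_le_one_le less_imp_le[OF frac_lt_1])
    ultimately have "t - of_nat K *\<^sub>R ?a - j \<in> P"
      using subspace_diff[OF hyperplane_subspace t' subsetD[OF rauzy_lattice_subset[OF LR] j]]
      by (simp add: P_def)
    from subsetD[OF T(3) this] obtain p
      where p: "p \<in> T" "norm (of_int (fst p) *\<^sub>R ?a + snd p - (t - of_nat K *\<^sub>R ?a - j)) < \<epsilon>"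
      unfolding UN_iff mem_ball dist_norm by blast
    define k where "k = nat (fst p + int K)"
    have "real k = of_int (fst p) + of_nat K" "k \<le> 2 * K"
      using K[OF p(1)] by (auto simp: k_def)
    then have "norm (of_nat k *\<^sub>R ?a + (snd p + j) - t) < \<epsilon>" "k \<le> 2 * K"
      using p(2) by (simp_all add: algebra_simps)
    moreover have "snd p + j \<in> ?J"
      using p(1) T(1) by (intro rauzy_lattice_group(2) j) auto
    ultimately show ?thesis by blast
  qed
  then show ?thesis by (rule that)
qed

section \<open>Lebesgue measure on a subspace\<close>

text \<open>
  In the coordinates \<open>\<phi>\<close> of the chosen orthonormal basis \<open>B\<close>, a translation by \<open>h\<close> is the translation
  \<open>\<tau>\<close> by \<open>h \<bullet> b\<close> in each coordinate \<open>b\<close>, a bounded set is contained in a box, and the unit box witnesses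
  that the measure is not zero.
\<close>

lemma lborel_subspace_properties:
  fixes S :: "'a::euclidean_space set"
  assumes S: "subspace S"
  shows sets_lborel_subspace: "sets (lborel_subspace S) = sets borel"
    and emeasure_lborel_subspace_translate:
      "h \<in> S \<Longrightarrow> A \<in> sets borel \<Longrightarrow>
        emeasure (lborel_subspace S) ((\<lambda>x. x + h) -` A) = emeasure (lborel_subspace S) A"
    and emeasure_lborel_subspace_ball: "emeasure (lborel_subspace S) (ball 0 \<rho>) < \<infinity>"
    and emeasure_lborel_subspace_self: "emeasure (lborel_subspace S) S \<noteq> 0"
proof -
  let ?orth = "\<lambda>B. B \<subseteq> S \<and> pairwise orthogonal B \<and> (\<forall>b\<in>B. norm b = 1) \<and> span B = S"
  define B where "B = (SOME B. ?orth B)"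
  have "\<exists>B. ?orth B"
  proof -
    obtain B where "B \<subseteq> S" "pairwise orthogonal B" "\<And>x. x \<in> B \<Longrightarrow> norm x = 1" "span B = S"
      by (rule orthonormal_basis_subspace[OF S]) blast
    then show ?thesis by blast
  qed
  then have "?orth B" unfolding B_def by (rule someI_ex)
  then have B: "B \<subseteq> S" "pairwise orthogonal B" "\<And>b. b \<in> B \<Longrightarrow> norm b = 1" "span B = S" by auto
  have fin: "finite B"
    using pairwise_orthogonal_imp_finite[OF B(2)] .
  define P where "P = (\<Pi>\<^sub>M b\<in>B. lborel :: real measure)"
  define \<phi> where "\<phi> c = (\<Sum>b\<in>B. c b *\<^sub>R b)" for c :: "'a \<Rightarrow> real"
  define \<nu> where "\<nu> = distr P borel \<phi>"
  have \<nu>: "lborel_subspace S = \<nu>"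
    by (simp add: lborel_subspace_def B_def[symmetric] Let_def \<nu>_def P_def \<phi>_def[abs_def])
  interpret product_sigma_finite "\<lambda>_ :: 'a. lborel :: real measure"
    by standard
  have \<phi>_meas [measurable]: "\<phi> \<in> measurable P borel"
    unfolding P_def \<phi>_def[abs_def] by measurable
  have em: "emeasure \<nu> A = emeasure P (\<phi> -` A \<inter> space P)" if "A \<in> sets borel" for A
    unfolding \<nu>_def using that by (subst emeasure_distr) auto
  have inner_B: "b \<bullet> b' = (if b = b' then 1 else 0)" if "b \<in> B" "b' \<in> B" for b b'
    using that B(2,3) by (auto simp: pairwise_def orthogonal_def dot_square_norm)
  have \<phi>_inner: "\<phi> c \<bullet> b = c b" if "b \<in> B" for c b
    using fin that by (simp add: \<phi>_def inner_sum_left inner_B if_distrib cong: if_cong)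
  have \<phi>_S: "\<phi> c \<in> S" for c
    unfolding \<phi>_def using B(1) by (intro subspace_sum[OF S] subspace_scale[OF S]) auto
  have \<phi>_expand: "\<phi> (\<lambda>b. h \<bullet> b) = h" if "h \<in> S" for h
  proof -
    have "h \<in> span B" using that B(4) by simp
    then obtain c where "h = \<phi> c"
      unfolding span_finite[OF fin] \<phi>_def[abs_def] by auto
    then have "\<phi> (\<lambda>b. h \<bullet> b) = \<phi> c"
      unfolding \<phi>_def[of "\<lambda>b. h \<bullet> b"] by (simp add: \<phi>_inner) (simp add: \<phi>_def)
    with \<open>h = \<phi> c\<close> show ?thesis by simp
  qed
  show "sets (lborel_subspace S) = sets borel"
    by (simp add: \<nu> \<nu>_def)
  show "emeasure (lborel_subspace S) ((\<lambda>x. x + h) -` A) = emeasure (lborel_subspace S) A"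
    if h: "h \<in> S" and A: "A \<in> sets borel"
  proof -
    define \<tau> where "\<tau> c = (\<lambda>b\<in>B. h \<bullet> b + c b)" for c :: "'a \<Rightarrow> real"
    have \<tau>_meas [measurable]: "\<tau> \<in> measurable P P"
      unfolding P_def \<tau>_def[abs_def] by measurable
    have "distr P P \<tau> = P"
      unfolding P_def
    proof (rule PiM_eqI[OF fin])
      fix X :: "'a \<Rightarrow> real set" assume X: "\<And>b. b \<in> B \<Longrightarrow> X b \<in> sets lborel"
      have "emeasure (distr P P \<tau>) (Pi\<^sub>E B X) = emeasure P (\<tau> -` Pi\<^sub>E B X \<inter> space P)"
        using X fin by (intro emeasure_distr \<tau>_meas) (auto simp: P_def intro!: sets_PiM_I_finite)
      also have "\<tau> -` Pi\<^sub>E B X \<inter> space P = (\<Pi>\<^sub>E b\<in>B. (+) (h \<bullet> b) -` X b)"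
        by (auto simp: P_def space_PiM \<tau>_def PiE_iff)
      also have "emeasure P \<dots> = (\<Prod>b\<in>B. emeasure lborel ((+) (h \<bullet> b) -` X b))"
        unfolding P_def using X fin by (intro emeasure_PiM) (auto intro!: measurable_sets_borel[where M=borel])
      also have "\<dots> = (\<Prod>b\<in>B. emeasure lborel (X b))"
      proof (rule prod.cong[OF refl])
        fix b assume "b \<in> B"
        then have "emeasure (distr lborel borel ((+) (h \<bullet> b))) (X b) =
            emeasure lborel ((+) (h \<bullet> b) -` X b \<inter> space lborel)"
          using X by (intro emeasure_distr) auto
        then show "emeasure lborel ((+) (h \<bullet> b) -` X b) = emeasure lborel (X b)"
          by (simp add: lborel_distr_plus)
      qed
      finally show "emeasure (distr (Pi\<^sub>M B (\<lambda>_. lborel)) (Pi\<^sub>M B (\<lambda>_. lborel)) \<tau>) (Pi\<^sub>E B X) =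
          (\<Prod>b\<in>B. emeasure lborel (X b))"
        by (simp add: P_def)
    qed simp
    moreover have "\<phi> (\<tau> c) = \<phi> c + h" for c
    proof -
      have "\<phi> (\<tau> c) = \<phi> (\<lambda>b. h \<bullet> b) + \<phi> c"
        by (simp add: \<phi>_def \<tau>_def scaleR_add_left sum.distrib)
      then show ?thesis by (simp add: \<phi>_expand[OF h] add.commute)
    qed
    then have "\<phi> -` ((\<lambda>x. x + h) -` A) \<inter> space P = \<tau> -` (\<phi> -` A \<inter> space P) \<inter> space P"
      using measurable_space[OF \<tau>_meas] by auto
    moreover have "(\<lambda>x. x + h) -` A \<in> sets borel"
      using A by (intro measurable_sets_borel[where M=borel]) auto
    moreover have "emeasure (distr P P \<tau>) (\<phi> -` A \<inter> space P) = emeasure P (\<tau> -` (\<phi> -` A \<inter> space P) \<inter> space P)"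
      using A by (intro emeasure_distr) auto
    ultimately show ?thesis
      using A by (simp add: \<nu> em)
  qed
  show "emeasure (lborel_subspace S) (ball 0 \<rho>) < \<infinity>"
  proof -
    have "\<phi> -` ball 0 \<rho> \<inter> space P \<subseteq> (\<Pi>\<^sub>E b\<in>B. {- \<rho>..\<rho>})"
    proof
      fix c assume c: "c \<in> \<phi> -` ball 0 \<rho> \<inter> space P"
      have "\<bar>c b\<bar> \<le> \<rho>" if "b \<in> B" for b
        using Cauchy_Schwarz_ineq2[of "\<phi> c" b] c that B(3)[OF that] by (simp add: \<phi>_inner)
      then show "c \<in> (\<Pi>\<^sub>E b\<in>B. {- \<rho>..\<rho>})"
        using c by (simp add: P_def space_PiM PiE_iff abs_le_iff minus_le_iff)
    qed
    then have "emeasure P (\<phi> -` ball 0 \<rho> \<inter> space P) \<le> emeasure P (\<Pi>\<^sub>E b\<in>B. {- \<rho>..\<rho>})"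
      using fin by (intro emeasure_mono) (auto simp: P_def intro!: sets_PiM_I_finite)
    also have "\<dots> = (\<Prod>b\<in>B. emeasure lborel {- \<rho>..\<rho>})"
      unfolding P_def using fin by (intro emeasure_PiM) auto
    also have "\<dots> < \<infinity>"
      by (simp add: ennreal_prod_eq_top less_top[symmetric] emeasure_lborel_Icc_eq del: prod_constant)
    finally show ?thesis by (simp add: \<nu> em)
  qed
  have S_borel: "S \<in> sets borel"
    using closed_subspace[OF S] by (rule borel_closed)
  show "emeasure (lborel_subspace S) S \<noteq> 0"
  proof -
    have "(1 :: ennreal) = (\<Prod>b\<in>B. emeasure lborel {0..1 :: real})" by simp
    also have "\<dots> = emeasure P (\<Pi>\<^sub>E b\<in>B. {0..1})"
      unfolding P_def using fin by (intro emeasure_PiM[symmetric]) auto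
    also have "\<dots> \<le> emeasure P (\<phi> -` S \<inter> space P)"
      using \<phi>_S by (intro emeasure_mono measurable_sets[OF \<phi>_meas S_borel]) (auto simp: P_def space_PiM)
    finally show ?thesis using S_borel by (auto simp: \<nu> em)
  qed
qed

lemma sigma_finite_lborel_subspace:
  fixes S :: "'a::euclidean_space set"
  assumes "subspace S"
  shows "sigma_finite_measure (lborel_subspace S)"
proof
  have sp: "space (lborel_subspace S) = UNIV"
    using sets_eq_imp_space_eq[OF sets_lborel_subspace[OF assms]] by simp
  show "\<exists>A. countable A \<and> A \<subseteq> sets (lborel_subspace S) \<and> \<Union>A = space (lborel_subspace S) \<and>
      (\<forall>a\<in>A. emeasure (lborel_subspace S) a \<noteq> \<infinity>)"
  proof (intro exI[of _ "range (\<lambda>n. ball 0 (real n))"] conjI ballI)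
    show "\<Union> (range (\<lambda>n. ball 0 (real n))) = space (lborel_subspace S)"
      using reals_Archimedean2 by (auto simp: sp)
  qed (use emeasure_lborel_subspace_ball[OF assms] in \<open>auto simp: sets_lborel_subspace[OF assms] less_top\<close>)
qed

section \<open>Counting visits of a rotation orbit\<close>

lemma vimage_translate_borel:
  fixes A :: "'a::euclidean_space set"
  shows "A \<in> sets borel \<Longrightarrow> (\<lambda>t. t + h) -` A \<in> sets borel"
  by (rule measurable_sets_borel[where M=borel]) auto

text \<open>
  A set wraps around the torus \<open>H / J\<close> without gaining measure: translating the part of \<open>F\<close> that is
  mapped into \<open>U\<close> by \<open>y + j\<close> gives the part of \<open>U\<close> in \<open>F + y + j\<close>, and these sets are disjoint for
  different \<open>j\<close>.
\<close>

lemma emeasure_Int_lattice_translates_le: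
  fixes \<nu> :: "'a::euclidean_space measure"
  assumes sets: "sets \<nu> = sets borel"
    and translate: "\<And>h A. h \<in> H \<Longrightarrow> A \<in> sets borel \<Longrightarrow> emeasure \<nu> ((\<lambda>x. x + h) -` A) = emeasure \<nu> A"
    and H: "subspace H" and J: "countable J" "J \<subseteq> H"
    and F: "fundamental_domain H J F" and y: "y \<in> H" and U: "U \<in> sets borel"
  shows "emeasure \<nu> (F \<inter> (\<Union>j\<in>J. (\<lambda>t. t + (y + j)) -` U)) \<le> emeasure \<nu> U"
proof -
  have Fb: "F \<in> sets borel" and FH: "F \<subseteq> H"
    and uniq: "\<And>x v w. x \<in> H \<Longrightarrow> v \<in> J \<Longrightarrow> w \<in> J \<Longrightarrow> x - v \<in> F \<Longrightarrow> x - w \<in> F \<Longrightarrow> v = w"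
    using F unfolding fundamental_domain_def by blast+
  define X where "X j = F \<inter> (\<lambda>t. t + (y + j)) -` U" for j
  define Y where "Y j = (\<lambda>t. t + - (y + j)) -` F \<inter> U" for j
  have X_borel: "X j \<in> sets borel" and Y_borel: "Y j \<in> sets borel" for j
    unfolding X_def Y_def using Fb U vimage_translate_borel by auto
  have eq: "emeasure \<nu> (X j) = emeasure \<nu> (Y j)" if "j \<in> J" for j
  proof -
    have "(\<lambda>t. t + (y + j)) -` Y j = X j"
      by (auto simp: X_def Y_def)
    moreover have "y + j \<in> H"
      using that J(2) y by (intro subspace_add[OF H]) auto
    ultimately show ?thesis
      using translate[of "y + j" "Y j"] Y_borel by simp
  qed
  \<comment> \<open>An injective enumeration of the countable set \<open>J\<close>, which may be finite.\<close>
  define I where "I = to_nat_on J ` J"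
  have enum: "from_nat_into J n \<in> J" if "n \<in> I" for n
    using that J(1) by (auto simp: I_def)
  have inj: "inj_on (from_nat_into J) I"
    using J(1) by (auto simp: I_def intro!: inj_onI)
  define X' where "X' n = (if n \<in> I then X (from_nat_into J n) else {})" for n
  define Y' where "Y' n = (if n \<in> I then Y (from_nat_into J n) else {})" for n
  have "F \<inter> (\<Union>j\<in>J. (\<lambda>t. t + (y + j)) -` U) \<subseteq> (\<Union>n. X' n)"
  proof
    fix t assume "t \<in> F \<inter> (\<Union>j\<in>J. (\<lambda>t. t + (y + j)) -` U)"
    then obtain j where "j \<in> J" "t \<in> X j" by (auto simp: X_def)
    then have "t \<in> X' (to_nat_on J j)"
      using J(1) by (auto simp: X'_def I_def)
    then show "t \<in> (\<Union>n. X' n)" by blast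
  qed
  then have "emeasure \<nu> (F \<inter> (\<Union>j\<in>J. (\<lambda>t. t + (y + j)) -` U)) \<le> emeasure \<nu> (\<Union>n. X' n)"
    using X_borel by (intro emeasure_mono sets.countable_UN) (auto simp: sets X'_def)
  also have "\<dots> \<le> (\<Sum>n. emeasure \<nu> (X' n))"
    using X_borel by (intro emeasure_subadditive_countably) (auto simp: sets X'_def)
  also have "\<dots> = (\<Sum>n. emeasure \<nu> (Y' n))"
    using enum eq by (intro suminf_cong) (simp add: X'_def Y'_def)
  also have "\<dots> = emeasure \<nu> (\<Union>n. Y' n)"
  proof (rule suminf_emeasure)
    show "disjoint_family Y'"
      unfolding disjoint_family_on_def
    proof (intro ballI impI, rule ccontr)
      fix m n :: nat assume mn: "m \<noteq> n" and "Y' m \<inter> Y' n \<noteq> {}"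
      then obtain t where t: "t \<in> Y' m" "t \<in> Y' n" by blast
      then have I: "m \<in> I" "n \<in> I" by (auto simp: Y'_def split: if_splits)
      define v w where "v = from_nat_into J m" and "w = from_nat_into J n"
      have vw: "v \<in> J" "w \<in> J" using enum I by (simp_all add: v_def w_def)
      have tv: "(t - y) - v \<in> F" "(t - y) - w \<in> F"
        using t I by (simp_all add: Y'_def Y_def v_def w_def algebra_simps)
      have "(t - y) - v + v \<in> H"
        using tv(1) FH vw(1) J(2) by (intro subspace_add[OF H]) auto
      then have "v = w"
        by (intro uniq[OF _ vw tv]) simp
      with inj I mn show False by (auto simp: v_def w_def dest: inj_onD)
    qed
  qed (use Y_borel in \<open>auto simp: sets Y'_def\<close>)
  also have "\<dots> \<le> emeasure \<nu> U"
    using U by (intro emeasure_mono) (auto simp: sets Y'_def Y_def)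
  finally show ?thesis .
qed

text \<open>
  The averaging argument. The set \<open>E m\<close> consists of the translations \<open>t\<close> that move the coset
  \<open>m \<alpha> + J\<close> to one meeting \<open>U\<close>. For each \<open>t\<close> some \<open>k \<le> K\<close> makes the \<open>k\<close>-step rotation nearly inverse to
  \<open>t\<close>, so a visit of \<open>x\<close> to \<open>A\<close> at time \<open>m\<close> forces \<open>t \<in> E (m + k)\<close>. It remains to integrate the resulting
  inequality of counts over \<open>t \<in> F\<close>.
\<close>

lemma card_visits_le:
  fixes \<nu> :: "'a::euclidean_space measure" and x :: "nat \<Rightarrow> 'a"
  assumes sets: "sets \<nu> = sets borel"
    and translate: "\<And>h A. h \<in> H \<Longrightarrow> A \<in> sets borel \<Longrightarrow> emeasure \<nu> ((\<lambda>x. x + h) -` A) = emeasure \<nu> A"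
    and H: "subspace H" and J: "countable J" "J \<subseteq> H"
    and J_add: "\<And>j j'. j \<in> J \<Longrightarrow> j' \<in> J \<Longrightarrow> j + j' \<in> J"
    and F: "fundamental_domain H J F"
    and \<alpha>: "\<alpha> \<in> H"
    and dense: "\<And>t. t \<in> H \<Longrightarrow> \<exists>k\<le>K. \<exists>j\<in>J. norm (of_nat k *\<^sub>R \<alpha> + j - t) < \<epsilon>"
    and U: "U \<in> sets borel" and AU: "\<And>y z. y \<in> A \<Longrightarrow> norm (z - y) < \<epsilon> \<Longrightarrow> z \<in> U"
    and x: "\<And>m. m < N \<Longrightarrow> x m - of_nat m *\<^sub>R \<alpha> \<in> J"
  shows "of_nat (card {m. m < N \<and> x m \<in> A}) * emeasure \<nu> F \<le> of_nat (N + K) * emeasure \<nu> U"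
proof -
  define E where "E m = (\<Union>j\<in>J. (\<lambda>t. t + (of_nat m *\<^sub>R \<alpha> + j)) -` U)" for m :: nat
  have E_borel: "E m \<in> sets borel" for m
    unfolding E_def using U J(1) by (intro sets.countable_UN'' vimage_translate_borel)
  have Fb: "F \<in> sets borel" and FH: "F \<subseteq> H"
    using F unfolding fundamental_domain_def by blast+
  have visits: "card {m. m < N \<and> x m \<in> A} \<le> card {m. m < N + K \<and> t \<in> E m}" if "t \<in> F" for t
  proof -
    have "- t \<in> H" using that FH subspace_neg[OF H] by blast
    then obtain k j where kj: "k \<le> K" "j \<in> J" "norm (of_nat k *\<^sub>R \<alpha> + j - (- t)) < \<epsilon>"
      using dense by blast
    have "(\<lambda>m. m + k) ` {m. m < N \<and> x m \<in> A} \<subseteq> {m. m < N + K \<and> t \<in> E m}"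
    proof (clarify, intro conjI)
      fix m assume m: "m < N" "x m \<in> A"
      show "m + k < N + K" using m kj by simp
      have "t + (of_nat (m + k) *\<^sub>R \<alpha> + (x m - of_nat m *\<^sub>R \<alpha> + j)) \<in> U"
        using kj(3) by (intro AU[OF m(2)]) (simp add: algebra_simps)
      moreover have "x m - of_nat m *\<^sub>R \<alpha> + j \<in> J"
        by (intro J_add x m kj)
      ultimately show "t \<in> E (m + k)"
        unfolding E_def by blast
    qed
    from card_mono[OF _ this] show ?thesis
      by (simp add: card_image)
  qed
  have "of_nat (card {m. m < N \<and> x m \<in> A}) * emeasure \<nu> F =
      (\<integral>\<^sup>+ t. of_nat (card {m. m < N \<and> x m \<in> A}) * indicator F t \<partial>\<nu>)"
    using Fb by (simp add: nn_integral_cmult_indicator sets)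
  also have "\<dots> \<le> (\<integral>\<^sup>+ t. (\<Sum>m<N + K. indicator (F \<inter> E m) t) \<partial>\<nu>)"
  proof (rule nn_integral_mono)
    fix t
    show "of_nat (card {m. m < N \<and> x m \<in> A}) * indicator F t \<le> (\<Sum>m<N + K. indicator (F \<inter> E m) t :: ennreal)"
    proof (cases "t \<in> F")
      case True
      have "(\<Sum>m<N + K. indicator (F \<inter> E m) t :: ennreal) = (\<Sum>m<N + K. if t \<in> E m then 1 else 0)"
        using True by (intro sum.cong) auto
      also have "\<dots> = of_nat (card {m. m < N + K \<and> t \<in> E m})"
        by (subst sum.If_cases) (auto simp: Int_def)
      finally show ?thesis using visits[OF True] True by simp
    qed simp
  qed
  also have "\<dots> = (\<Sum>m<N + K. emeasure \<nu> (F \<inter> E m))"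
    using Fb E_borel by (subst nn_integral_sum) (auto simp: sets intro!: borel_measurable_indicator)
  also have "\<dots> \<le> (\<Sum>m<N + K. emeasure \<nu> U)"
    unfolding E_def
    by (intro sum_mono emeasure_Int_lattice_translates_le[OF sets translate H J F] subspace_scale[OF H] \<alpha> U)
  finally show ?thesis by simp
qed

text \<open>
  Countably many translates of \<open>F\<close> cover \<open>H\<close>.
\<close>

lemma emeasure_fundamental_domain_pos:
  fixes \<nu> :: "'a::euclidean_space measure"
  assumes sets: "sets \<nu> = sets borel"
    and translate: "\<And>h A. h \<in> H \<Longrightarrow> A \<in> sets borel \<Longrightarrow> emeasure \<nu> ((\<lambda>x. x + h) -` A) = emeasure \<nu> A"
    and H: "subspace H" and J: "countable J" "J \<subseteq> H" and F: "fundamental_domain H J F"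
    and H0: "emeasure \<nu> H \<noteq> 0"
  shows "emeasure \<nu> F \<noteq> 0"
proof
  assume F0: "emeasure \<nu> F = 0"
  have Fb: "F \<in> sets borel" using F by (simp add: fundamental_domain_def)
  have "(\<lambda>x. x + - v) -` F \<in> null_sets \<nu>" if "v \<in> J" for v
  proof (rule null_setsI)
    show "emeasure \<nu> ((\<lambda>x. x + - v) -` F) = 0"
      using translate[OF subspace_neg[OF H] Fb, of v] that J(2) F0 by auto
    show "(\<lambda>x. x + - v) -` F \<in> sets \<nu>"
      unfolding sets using Fb by (rule vimage_translate_borel)
  qed
  then have "(\<Union>v\<in>J. (\<lambda>x. x + - v) -` F) \<in> null_sets \<nu>"
    by (intro null_sets_UN' J)
  moreover have "H \<subseteq> (\<Union>v\<in>J. (\<lambda>x. x + - v) -` F)"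
  proof
    fix x assume "x \<in> H"
    then obtain v where "v \<in> J" "x - v \<in> F"
      using F unfolding fundamental_domain_def by blast
    then show "x \<in> (\<Union>v\<in>J. (\<lambda>x. x + - v) -` F)" by auto
  qed
  moreover have "H \<in> sets \<nu>"
    using closed_subspace[OF H] by (simp add: sets)
  ultimately have "H \<in> null_sets \<nu>"
    using null_sets_subset by blast
  with H0 show False by auto
qed

text \<open>
  Inner regularity extends the bound to all Borel sets, so there is a Radon--Nikodym derivative \<open>f\<close>.
  Comparing both measures on \<open>{f > D}\<close> shows that \<open>f \<le> D\<close> almost everywhere, and
  \<open>min f D\<close> is a version of \<open>f\<close> that is bounded everywhere.
\<close>

lemma bounded_density_if_bounded_on_compacts:
  fixes \<mu> \<nu> :: "'a::euclidean_space measure"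
  assumes \<mu>: "sets \<mu> = sets borel" "finite_measure \<mu>"
    and \<nu>: "sets \<nu> = sets borel" "sigma_finite_measure \<nu>"
    and le: "\<And>C. compact C \<Longrightarrow> emeasure \<mu> C \<le> ennreal D * emeasure \<nu> C"
  shows "absolutely_continuous \<nu> \<mu> \<and>
    (\<exists>f\<in>borel_measurable borel. \<mu> = density \<nu> f \<and> (\<forall>x. f x \<le> ennreal D))"
proof -
  interpret \<mu>: finite_measure \<mu> by fact
  interpret \<nu>: sigma_finite_measure \<nu> by fact
  have le': "emeasure \<mu> A \<le> ennreal D * emeasure \<nu> A" if A: "A \<in> sets borel" for A
  proof -
    have "emeasure \<mu> A = (SUP C\<in>{C. C \<subseteq> A \<and> compact C}. emeasure \<mu> C)"
      using \<mu> A by (intro inner_regular) auto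
    also have "\<dots> \<le> ennreal D * emeasure \<nu> A"
    proof (rule SUP_least)
      fix C assume "C \<in> {C. C \<subseteq> A \<and> compact C}"
      then have "emeasure \<mu> C \<le> ennreal D * emeasure \<nu> C" "emeasure \<nu> C \<le> emeasure \<nu> A"
        using A by (auto intro: le emeasure_mono simp: \<nu>)
      then show "emeasure \<mu> C \<le> ennreal D * emeasure \<nu> A"
        by (meson mult_left_mono order_trans zero_le)
    qed
    finally show ?thesis .
  qed
  have ac: "absolutely_continuous \<nu> \<mu>"
    unfolding absolutely_continuous_def
  proof
    fix A assume A: "A \<in> null_sets \<nu>"
    then have "A \<in> sets borel" "emeasure \<nu> A = 0"
      using \<nu>(1) by auto
    with le'[of A] have "emeasure \<mu> A \<le> 0"
      by simp
    then show "A \<in> null_sets \<mu>"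
      using \<open>A \<in> sets borel\<close> by (intro null_setsI) (auto simp: \<mu>)
  qed
  then obtain f where f[measurable]: "f \<in> borel_measurable \<nu>" and dens: "density \<nu> f = \<mu>"
    using \<nu>.Radon_Nikodym[of \<mu>] \<mu> \<nu> by auto
  define S where "S = {x \<in> space \<nu>. ennreal D < f x}"
  have S[measurable]: "S \<in> sets \<nu>"
    unfolding S_def by measurable
  have S_le: "(\<integral>\<^sup>+ x. f x * indicator S x \<partial>\<nu>) \<le> (\<integral>\<^sup>+ x. ennreal D * indicator S x \<partial>\<nu>)"
    using le'[of S] S f emeasure_density[OF f S]
    by (simp add: dens \<nu> nn_integral_cmult_indicator)
  have fin: "(\<integral>\<^sup>+ x. ennreal D * indicator S x \<partial>\<nu>) \<noteq> \<infinity>"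
  proof -
    have "(\<integral>\<^sup>+ x. ennreal D * indicator S x \<partial>\<nu>) \<le> (\<integral>\<^sup>+ x. f x * indicator S x \<partial>\<nu>)"
      by (intro nn_integral_mono) (auto simp: S_def indicator_def)
    also have "\<dots> = emeasure \<mu> S"
      using emeasure_density[OF f S] by (simp add: dens)
    finally show ?thesis using \<mu>.emeasure_finite[of S] by (auto simp: top_unique)
  qed
  have "(\<integral>\<^sup>+ x. f x * indicator S x - ennreal D * indicator S x \<partial>\<nu>) =
      (\<integral>\<^sup>+ x. f x * indicator S x \<partial>\<nu>) - (\<integral>\<^sup>+ x. ennreal D * indicator S x \<partial>\<nu>)"
    using fin by (intro nn_integral_diff) (auto simp: S_def indicator_def intro!: AE_I2)
  also have "\<dots> = 0"
    using S_le le_less_trans[OF S_le] fin by (simp add: diff_eq_0_iff_ennreal less_top)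
  finally have "AE x in \<nu>. f x * indicator S x - ennreal D * indicator S x = 0"
    by (subst (asm) nn_integral_0_iff_AE) auto
  then have "AE x in \<nu>. f x = min (f x) (ennreal D)"
  proof (rule AE_mp, intro AE_I2 impI)
    fix x assume x: "x \<in> space \<nu>" "f x * indicator S x - ennreal D * indicator S x = 0"
    have "f x \<le> ennreal D"
    proof (rule ccontr)
      assume "\<not> f x \<le> ennreal D"
      then have "x \<in> S" using x(1) by (simp add: S_def)
      with x(2) have "f x - ennreal D = 0" by simp
      with \<open>\<not> f x \<le> ennreal D\<close> show False
        by (metis diff_gt_0_iff_gt_ennreal less_irrefl not_le)
    qed
    then show "f x = min (f x) (ennreal D)" by simp
  qed
  then have "density \<nu> f = density \<nu> (\<lambda>x. min (f x) (ennreal D))"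
    by (intro density_cong) auto
  then have "\<mu> = density \<nu> (\<lambda>x. min (f x) (ennreal D))"
    by (simp add: dens)
  moreover have "(\<lambda>x. min (f x) (ennreal D)) \<in> borel_measurable borel"
    using f by (simp add: measurable_cong_sets[OF \<nu>(1) refl])
  ultimately show ?thesis
    using ac by (intro conjI bexI[of _ "\<lambda>x. min (f x) (ennreal D)"]) auto
qed

section \<open>Realisations of random substitutions and their measures\<close>

lemma abelianise_simps:
  "abelianise [] = 0" "abelianise (a # u) = axis a 1 + abelianise u"
  "abelianise (u @ w) = abelianise u + abelianise w"
  by (simp_all add: abelianise_def vec_eq_iff axis_def)

lemma sum_abelianise: "(\<Sum>i\<in>UNIV. abelianise (u :: 'd::finite list) $ i) = real (length u)"
proof -
  have "(\<Sum>i\<in>UNIV. count_list u i) = length u"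
    by (rule sum_count_set) auto
  then show ?thesis
    by (simp add: abelianise_def flip: of_nat_sum)
qed

lemma abelianise_letter_image:
  fixes \<theta> :: "'d::finite \<Rightarrow> 'd list pmf"
  assumes "compatible \<theta>" and "w \<in> set_pmf (\<theta> a)"
  shows "abelianise w = of_int_matrix (subst_matrix \<theta>) *v axis a 1"
proof -
  have "(SOME v. v \<in> set_pmf (\<theta> a)) \<in> set_pmf (\<theta> a)"
    using assms(2) by (rule someI)
  then have "count_list w i = count_list (SOME v. v \<in> set_pmf (\<theta> a)) i" for i
    using assms unfolding compatible_def by blast
  then show ?thesis
    by (simp add: vec_eq_iff abelianise_def matrix_vector_mult_basis column_def of_int_matrix_def
        subst_matrix_def)
qed

lemma abelianise_subst_word:
  fixes \<theta> :: "'d::finite \<Rightarrow> 'd list pmf"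
  assumes "compatible \<theta>" and "w \<in> set_pmf (subst_word \<theta> u)"
  shows "abelianise w = of_int_matrix (subst_matrix \<theta>) *v abelianise u"
  using assms(2)
proof (induction u arbitrary: w)
  case (Cons a u)
  then obtain x y where "x \<in> set_pmf (\<theta> a)" "y \<in> set_pmf (subst_word \<theta> u)" "w = x @ y"
    by auto
  then show ?case
    using Cons.IH[of y] abelianise_letter_image[OF assms(1), of x a]
    by (simp add: abelianise_simps matrix_vector_right_distrib)
qed (simp add: abelianise_simps)

lemma abelianise_subst_iter:
  fixes \<theta> :: "'d::finite \<Rightarrow> 'd list pmf"
  assumes "compatible \<theta>" and "w \<in> set_pmf (subst_iter \<theta> n v)"
  shows "abelianise w = (((*v) (of_int_matrix (subst_matrix \<theta>))) ^^ n) (abelianise v)"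
  using assms(2)
proof (induction n arbitrary: w)
  case (Suc n)
  then obtain u where "u \<in> set_pmf (subst_iter \<theta> n v)" "w \<in> set_pmf (subst_word \<theta> u)"
    by auto
  then show ?case
    using Suc.IH[of u] abelianise_subst_word[OF assms(1), of w u] by simp
qed simp

lemma length_subst_iter:
  fixes \<theta> :: "'d::finite \<Rightarrow> 'd list pmf"
  assumes "compatible \<theta>" and w: "w \<in> set_pmf (subst_iter \<theta> n v)"
  shows "length w = iter_length \<theta> n v"
proof -
  have "length w' = length w" if "w' \<in> set_pmf (subst_iter \<theta> n v)" for w'
    using abelianise_subst_iter[OF assms(1) that] abelianise_subst_iter[OF assms] sum_abelianise[of w]
      sum_abelianise[of w'] by simp
  then have "length ` set_pmf (subst_iter \<theta> n v) = (\<lambda>_. length w) ` set_pmf (subst_iter \<theta> n v)"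
    by (intro image_cong refl)
  also have "\<dots> = {length w}"
    using w by (rule image_constant)
  finally have "length ` set_pmf (subst_iter \<theta> n v) = {length w}" .
  then show ?thesis by (simp add: iter_length_def)
qed

text \<open>
  Weighting the letters by \<open>L\<close> turns the length into a quantity that is multiplied by exactly \<open>l\<close> in
  each step.
\<close>

lemma iter_length_growth:
  fixes \<theta> :: "'d::finite \<Rightarrow> 'd list pmf" and L :: "real ^ 'd"
  assumes comp: "compatible \<theta>" and v: "v \<noteq> []" and l: "1 < l"
    and L: "\<And>i. 0 < L $ i" "L v* of_int_matrix (subst_matrix \<theta>) = l *s L"
  shows "0 < iter_length \<theta> n v"
    and "filterlim (\<lambda>n. iter_length \<theta> n v) at_top sequentially"
proof -
  let ?M = "of_int_matrix (subst_matrix \<theta>) :: real ^ 'd ^ 'd"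
  define c where "c = L \<bullet> abelianise v"
  define b where "b = (\<Sum>i\<in>UNIV. L $ i)"
  have Lle: "L $ i \<le> b" for i
    unfolding b_def by (intro member_le_sum) (auto intro: less_imp_le[OF L(1)])
  have b: "0 < b" using Lle L(1) less_le_trans by blast
  have c: "0 < c"
  proof -
    from v obtain a u where "v = a # u" by (cases v) auto
    moreover have "0 \<le> L \<bullet> abelianise u"
      by (simp add: inner_vec_def abelianise_def sum_nonneg less_imp_le[OF L(1)])
    ultimately show ?thesis
      using L(1)[of a] by (simp add: c_def abelianise_simps inner_add_right inner_axis)
  qed
  have step: "L \<bullet> (?M *v x) = l * (L \<bullet> x)" for x
    using dot_lmul_matrix[of L ?M x] by (simp add: L(2) inner_vec_def sum_distrib_left mult.assoc)
  have growth: "l ^ n * c \<le> b * real (iter_length \<theta> n v)" for n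
  proof -
    obtain w where w: "w \<in> set_pmf (subst_iter \<theta> n v)"
      using set_pmf_not_empty[of "subst_iter \<theta> n v"] by blast
    have "L \<bullet> ((((*v) ?M) ^^ n) x) = l ^ n * (L \<bullet> x)" for x
      by (induction n) (simp_all add: step)
    then have "l ^ n * c = L \<bullet> abelianise w"
      using abelianise_subst_iter[OF comp w] by (simp add: c_def)
    also have "\<dots> \<le> (\<Sum>i\<in>UNIV. b * abelianise w $ i)"
      unfolding inner_vec_def by (intro sum_mono) (simp add: abelianise_def mult_right_mono Lle)
    also have "\<dots> = b * real (iter_length \<theta> n v)"
      by (simp add: sum_distrib_left[symmetric] sum_abelianise length_subst_iter[OF comp w])
    finally show ?thesis .
  qed
  show "0 < iter_length \<theta> n v"
  proof (rule ccontr)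
    assume "\<not> 0 < iter_length \<theta> n v"
    then have "l ^ n * c \<le> 0" using growth[of n] by simp
    moreover have "0 < l ^ n * c" using l c by (intro mult_pos_pos zero_less_power) auto
    ultimately show False by simp
  qed
  have "filterlim (\<lambda>n. l ^ n) at_top sequentially"
    using l filterlim_realpow_sequentially_gt1[of l]
    by (intro filterlim_at_infinity_imp_filterlim_at_top) simp_all
  then have "filterlim (\<lambda>n. c / b * l ^ n) at_top sequentially"
    using b c by (intro filterlim_tendsto_pos_mult_at_top[OF tendsto_const]) simp_all
  moreover have "\<forall>n. c / b * l ^ n \<le> real (iter_length \<theta> n v)"
  proof
    fix n
    have "c / b * l ^ n = l ^ n * c / b" by simp
    also have "\<dots> \<le> b * real (iter_length \<theta> n v) / b"
      using growth[of n] b by (intro divide_right_mono) simp_all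
    finally show "c / b * l ^ n \<le> real (iter_length \<theta> n v)" using b by simp
  qed
  ultimately have "filterlim (\<lambda>n. real (iter_length \<theta> n v)) at_top sequentially"
    by (rule filterlim_at_top_mono[OF _ always_eventually])
  then show "filterlim (\<lambda>n. iter_length \<theta> n v) at_top sequentially"
    unfolding filterlim_sequentially_iff_filterlim_real .
qed

lemma emeasure_word_measure:
  fixes L R :: "real ^ 'd::finite"
  assumes "A \<in> sets borel"
  shows "emeasure (word_measure L R a w) A =
    of_nat (card {m. m < length w \<and> w ! m = a \<and> proj L R (abelianise (take m w)) \<in> A})"
proof -
  have "emeasure (word_measure L R a w) A = emeasure (count_space {m. m < length w \<and> w ! m = a})
      ((\<lambda>m. proj L R (abelianise (take m w))) -` A \<inter> {m. m < length w \<and> w ! m = a})"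
    unfolding word_measure_def using assms by (subst emeasure_distr) auto
  also have "\<dots> = of_nat (card ((\<lambda>m. proj L R (abelianise (take m w))) -` A \<inter> {m. m < length w \<and> w ! m = a}))"
    by (intro emeasure_count_space_finite) auto
  finally show ?thesis
    by (simp add: Int_def vimage_def conj_ac)
qed

lemma sets_word_measure: "sets (word_measure L R a w) = sets borel"
  by (simp add: word_measure_def)

lemma sets_expected_word_measure:
  fixes L R :: "real ^ 'a::finite"
  shows "sets (expected_word_measure \<theta> L R a n v) = sets borel"
  unfolding expected_word_measure_def
  using sets.sigma_sets_eq[of "borel :: (real ^ 'a) measure"] by (simp add: sets_measure_of)

text \<open>
  Countable additivity is the interchange of a countable sum with the expectation.
\<close>

lemma emeasure_expected_word_measure:
  assumes "A \<in> sets borel"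
  shows "emeasure (expected_word_measure \<theta> L R a n v) A =
    (\<integral>\<^sup>+ w. emeasure (word_measure L R a w) A \<partial>measure_pmf (subst_iter \<theta> n v))"
proof (rule emeasure_measure_of[OF expected_word_measure_def])
  let ?\<mu> = "\<lambda>A. \<integral>\<^sup>+ w. emeasure (word_measure L R a w) A \<partial>measure_pmf (subst_iter \<theta> n v)"
  show "positive (sets (expected_word_measure \<theta> L R a n v)) ?\<mu>"
    by (simp add: positive_def)
  show "countably_additive (sets (expected_word_measure \<theta> L R a n v)) ?\<mu>"
  proof (rule countably_additiveI)
    fix A :: "nat \<Rightarrow> (real ^ 'a) set"
    assume A: "range A \<subseteq> sets (expected_word_measure \<theta> L R a n v)" "disjoint_family A"
    have "(\<Sum>i. ?\<mu> (A i)) = (\<integral>\<^sup>+ w. (\<Sum>i. emeasure (word_measure L R a w) (A i)) \<partial>measure_pmf (subst_iter \<theta> n v))"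
      by (rule nn_integral_suminf[symmetric]) simp
    also have "\<dots> = ?\<mu> (\<Union>i. A i)"
      using A by (intro nn_integral_cong suminf_emeasure) (simp_all add: sets_word_measure sets_expected_word_measure)
    finally show "(\<Sum>i. ?\<mu> (A i)) = ?\<mu> (\<Union>i. A i)" .
  qed
qed (use assms in \<open>simp_all add: sets_expected_word_measure\<close>)

lemma emeasure_expected_word_measure_le:
  assumes A: "A \<in> sets borel"
    and le: "\<And>w. w \<in> set_pmf (subst_iter \<theta> n v) \<Longrightarrow> emeasure (word_measure L R a w) A \<le> c"
  shows "emeasure (expected_word_measure \<theta> L R a n v) A \<le> c"
proof -
  have "emeasure (expected_word_measure \<theta> L R a n v) A \<le> (\<integral>\<^sup>+ w. c \<partial>measure_pmf (subst_iter \<theta> n v))"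
    unfolding emeasure_expected_word_measure[OF A]
    using le by (intro nn_integral_mono_AE) (simp add: AE_measure_pmf_iff)
  then show ?thesis by simp
qed

text \<open>
  The function \<open>f\<close> below is a continuous function between the indicators of \<open>C\<close> and of its open
  \<open>\<epsilon>\<close>-neighbourhood.
\<close>

lemma weak_limit_compact_le:
  fixes \<mu> :: "'a::euclidean_space measure"
  assumes wl: "weak_limit M \<mu>" and C: "compact C" "C \<noteq> {}" and eps: "0 < \<epsilon>"
    and M: "\<And>n. finite_measure (M n)" "\<And>n. sets (M n) = sets borel"
    and le: "\<And>n. emeasure (M n) {x. infdist x C < \<epsilon>} \<le> ennreal (b n)" "\<And>n. 0 \<le> b n"
    and b: "b \<longlonglongrightarrow> B"
  shows "emeasure \<mu> C \<le> ennreal B"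
proof -
  define f where "f x = max 0 (1 - infdist x C / \<epsilon>)" for x
  let ?A = "{x. infdist x C < \<epsilon>}"
  have \<mu>: "sets \<mu> = sets borel" and fin: "finite_measure \<mu>"
    using wl by (auto simp: weak_limit_def)
  have cont: "continuous_on UNIV f"
    unfolding f_def[abs_def] using eps by (intro continuous_intros) auto
  have f01: "0 \<le> f x" "f x \<le> 1" for x
    using eps by (auto simp: f_def infdist_nonneg)
  then have bdd: "bounded (range f)"
    by (intro boundedI[of _ 1]) auto
  have lim: "(\<lambda>n. integral\<^sup>L (M n) f) \<longlonglongrightarrow> integral\<^sup>L \<mu> f"
    using wl cont bdd unfolding weak_limit_def by blast
  have A: "?A \<in> sets borel"
    by (intro borel_open open_Collect_less continuous_intros)
  have f_int: "integrable N f" if "finite_measure N" "sets N = sets borel" for N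
  proof -
    interpret finite_measure N by fact
    show ?thesis
      using f01 borel_measurable_continuous_onI[OF cont]
      by (intro integrable_const_bound[of _ 1]) (auto simp: measurable_cong_sets[OF that(2) refl])
  qed
  have "integral\<^sup>L (M n) f \<le> b n" for n
  proof -
    interpret finite_measure "M n" by fact
    have "integral\<^sup>L (M n) f \<le> integral\<^sup>L (M n) (indicator ?A)"
    proof (intro integral_mono f_int[OF M])
      show "f x \<le> indicator ?A x" for x
        using f01(2)[of x] eps by (cases "infdist x C < \<epsilon>") (simp_all add: f_def field_simps)
    qed (use A in \<open>simp add: M emeasure_eq_measure\<close>)
    also have "\<dots> = measure (M n) ?A"
      using A M by simp
    also have "\<dots> \<le> b n"
      using le(1)[of n] le(2)[of n] by (simp add: emeasure_eq_measure)
    finally show ?thesis .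
  qed
  then have "integral\<^sup>L \<mu> f \<le> B"
    by (intro LIMSEQ_le[OF lim b]) auto
  moreover have "measure \<mu> C \<le> integral\<^sup>L \<mu> f"
  proof -
    interpret finite_measure \<mu> by fact
    have Cb: "C \<in> sets borel" using C by (intro borel_closed compact_imp_closed)
    have "measure \<mu> C = integral\<^sup>L \<mu> (indicator C)" using Cb \<mu> by simp
    also have "\<dots> \<le> integral\<^sup>L \<mu> f"
    proof (intro integral_mono f_int[OF fin \<mu>])
      show "indicator C x \<le> f x" for x
        using f01(1)[of x] by (cases "x \<in> C") (simp_all add: f_def)
    qed (use Cb in \<open>simp add: \<mu> emeasure_eq_measure\<close>)
    finally show ?thesis .
  qed
  ultimately show ?thesis
    using finite_measure.emeasure_eq_measure[OF fin, of C] by (simp add: ennreal_leI)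
qed

text \<open>
  This confines a realisation at time \<open>m\<close> to the \<open>m\<close>-th coset of the rotation orbit.
\<close>

lemma prefix_lattice_coset:
  fixes L R :: "real ^ 'd"
  assumes "m \<le> length w"
  shows "proj L R (abelianise (take m w)) - of_nat m *\<^sub>R proj L R (axis r 1) \<in> rauzy_lattice L R r"
proof -
  have "abelianise (take m w) $ i = of_int (int (count_list (take m w) i))" for i
    by (simp add: abelianise_def)
  from proj_lattice_coset[OF this] show ?thesis
    using assms by (simp add: sum_abelianise)
qed

lemma pf_eigenvalue_unique: "pf_eigenvalue M l \<Longrightarrow> pf_eigenvalue M l' \<Longrightarrow> l = l'"
  unfolding pf_eigenvalue_def by (smt (verit) norm_of_real)

lemma thickening_compact:
  fixes C :: "'a::euclidean_space set"
  assumes C: "compact C" "C \<noteq> {}"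
  shows "\<exists>\<rho>. {x. infdist x C < e} \<subseteq> ball 0 \<rho>"
    and "(\<Inter>n::nat. {x. infdist x C < 2 / real (Suc n)}) = C"
proof -
  obtain B where B: "\<And>y. y \<in> C \<Longrightarrow> norm y \<le> B"
    using compact_imp_bounded[OF C(1)] by (auto simp: bounded_iff)
  have "{x. infdist x C < e} \<subseteq> ball 0 (B + e)"
  proof
    fix x assume x: "x \<in> {x. infdist x C < e}"
    obtain y where "y \<in> C" "infdist x C = dist x y"
      using infdist_attains_inf[OF compact_imp_closed[OF C(1)] C(2)] by blast
    then show "x \<in> ball 0 (B + e)"
      using x B[of y] norm_triangle_ineq2[of x y] by (simp add: dist_norm)
  qed
  then show "\<exists>\<rho>. {x. infdist x C < e} \<subseteq> ball 0 \<rho>" by blast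
  show "(\<Inter>n::nat. {x. infdist x C < 2 / real (Suc n)}) = C"
  proof (intro equalityI subsetI)
    fix x assume x: "x \<in> (\<Inter>n::nat. {x. infdist x C < 2 / real (Suc n)})"
    have "infdist x C \<le> 0"
    proof (rule LIMSEQ_le_const)
      show "(\<lambda>n. 2 / real (Suc n)) \<longlonglongrightarrow> 0"
        using tendsto_mult[OF tendsto_const LIMSEQ_inverse_real_of_nat, of 2] by (simp add: divide_inverse)
    qed (use x in \<open>auto intro: less_imp_le\<close>)
    then show "x \<in> C"
      using in_closed_iff_infdist_zero[OF compact_imp_closed[OF C(1)] C(2)] infdist_nonneg[of x C] by simp
  qed simp
qed

section \<open>Absolute continuity of Rauzy measures\<close>

theorem corollary5p18:
  fixes \<theta> :: "'d::finite \<Rightarrow> 'd list pmf"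
    and L R :: "real ^ 'd"
    and v :: "'d list"
    and \<mu> :: "'d \<Rightarrow> (real ^ 'd) measure"
    and r :: 'd
    and F :: "(real ^ 'd) set"
    and D :: real
  assumes "random_substitution \<theta>"
    and "compatible \<theta>"
    and "irreducible_pisot \<theta>"
    and "pf_eigenvectors (subst_matrix \<theta>) L R"
    and "v \<noteq> []"
    and "\<And>a. rauzy_measure \<theta> L R v a (\<mu> a)"
    and "fundamental_domain (hyperplane L) (rauzy_lattice L R r) F"
    and "D = 1 / measure (lborel_subspace (hyperplane L)) F"
  shows "\<forall>a. absolutely_continuous (lborel_subspace (hyperplane L)) (\<mu> a) \<and>
           (\<exists>f \<in> borel_measurable borel.
              \<mu> a = density (lborel_subspace (hyperplane L)) f \<and> (\<forall>x. f x \<le> ennreal D))"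
proof
  fix a
  let ?H = "hyperplane L" and ?J = "rauzy_lattice L R r" and ?\<alpha> = "proj L R (axis r 1)"
  define \<nu> where "\<nu> = lborel_subspace ?H"
  note H = hyperplane_subspace[of L]
  have \<nu>: "sets \<nu> = sets borel" "sigma_finite_measure \<nu>"
    by (simp_all add: \<nu>_def sets_lborel_subspace[OF H] sigma_finite_lborel_subspace[OF H])
  have translate: "emeasure \<nu> ((\<lambda>x. x + h) -` A) = emeasure \<nu> A" if "h \<in> ?H" "A \<in> sets borel" for h A
    unfolding \<nu>_def by (rule emeasure_lborel_subspace_translate[OF H that])
  have \<nu>_ball: "emeasure \<nu> (ball 0 \<rho>) < \<infinity>" for \<rho>
    unfolding \<nu>_def by (rule emeasure_lborel_subspace_ball[OF H])
  have \<nu>_H: "emeasure \<nu> ?H \<noteq> 0"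
    unfolding \<nu>_def by (rule emeasure_lborel_subspace_self[OF H])

  obtain l where l: "pf_eigenvalue (subst_matrix \<theta>) l"
    "L v* of_int_matrix (subst_matrix \<theta>) = l *s L" "of_int_matrix (subst_matrix \<theta>) *v R = l *s R"
    and L: "\<And>i. 0 < L $ i" and R: "\<And>i. 0 < R $ i" and "(\<Sum>i\<in>UNIV. \<bar>R $ i\<bar>) = 1" and LR: "L \<bullet> R = 1"
    using assms(4) unfolding pf_eigenvectors_def by blast
  then have R1: "(\<Sum>i\<in>UNIV. R $ i) = 1"
    by (simp add: abs_of_pos)
  have l1: "1 < l"
    using assms(3) l(1) pf_eigenvalue_unique unfolding irreducible_pisot_def pisot_number_def by blast
  have indep: "\<forall>c :: 'd \<Rightarrow> int. (\<Sum>i\<in>UNIV. of_int (c i) * R $ i) = 0 \<longrightarrow> (\<forall>i. c i = 0)"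
    using assms(3) eigenvector_entries_integrally_independent[OF _ _ R l(3)]
    unfolding irreducible_pisot_def by blast
  have \<alpha>: "?\<alpha> \<in> ?H" by (rule proj_in_hyperplane[OF LR])
  note lattice = countable_rauzy_lattice rauzy_lattice_subset[OF LR]
  have visits: "of_nat (card {m. m < N \<and> x m \<in> A}) * emeasure \<nu> F \<le> of_nat (N + K) * emeasure \<nu> U"
    if "\<And>t. t \<in> ?H \<Longrightarrow> \<exists>k\<le>K. \<exists>j\<in>?J. norm (of_nat k *\<^sub>R ?\<alpha> + j - t) < \<epsilon>"
      and "U \<in> sets borel" and "\<And>y z. y \<in> A \<Longrightarrow> norm (z - y) < \<epsilon> \<Longrightarrow> z \<in> U"
      and "\<And>m. m < N \<Longrightarrow> x m - of_nat m *\<^sub>R ?\<alpha> \<in> ?J" for N K x A U \<epsilon>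
    by (rule card_visits_le[where H = ?H and J = ?J and \<alpha> = ?\<alpha> and \<epsilon> = \<epsilon> and A = A and x = x])
      (fact \<nu>(1) translate H lattice rauzy_lattice_group(2) assms(7) \<alpha> that)+

  \<comment> \<open>If \<open>F\<close> had infinite measure, its real-valued measure would be \<open>0\<close> and \<open>D\<close> would be
    \<open>1 / 0\<close>. A single visit to \<open>0\<close> at time \<open>0\<close> already bounds the measure of \<open>F\<close>
    by a multiple of that of a ball.\<close>
  have F_fin: "emeasure \<nu> F \<noteq> \<infinity>"
  proof -
    obtain K where K: "\<And>t. t \<in> ?H \<Longrightarrow> \<exists>k\<le>K. \<exists>j\<in>?J. norm (of_nat k *\<^sub>R ?\<alpha> + j - t) < 1"
      using lattice_orbit_uniformly_dense[OF LR R1 indep zero_less_one] by blast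
    have "of_nat (card {m. m < Suc 0 \<and> (0 :: real ^ 'd) \<in> {0}}) * emeasure \<nu> F
        \<le> of_nat (Suc 0 + K) * emeasure \<nu> (ball 0 1)"
      by (rule visits[OF K]) (auto simp: rauzy_lattice_group)
    also have "\<dots> < \<infinity>"
      using \<nu>_ball[of 1] by (simp add: ennreal_mult_less_top of_nat_less_top)
    finally show ?thesis by simp
  qed
  define \<phi> where "\<phi> = measure \<nu> F"
  have F: "emeasure \<nu> F = ennreal \<phi>"
    using F_fin by (simp add: \<phi>_def emeasure_eq_ennreal_measure)
  have "emeasure \<nu> F \<noteq> 0"
    by (rule emeasure_fundamental_domain_pos[where H = ?H and J = ?J])
      (fact \<nu>(1) translate H lattice assms(7) \<nu>_H)+
  then have \<phi>: "0 < \<phi>"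
    by (simp add: F ennreal_eq_0_iff not_le)
  have D: "D = 1 / \<phi>" by (simp add: assms(8) \<phi>_def \<nu>_def)

  define N where "N n = iter_length \<theta> n v" for n
  have N: "0 < N n" for n
    unfolding N_def by (rule iter_length_growth(1)[OF assms(2,5) l1 L l(2)])
  have N_lim: "filterlim N at_top sequentially"
    unfolding N_def[abs_def] by (rule iter_length_growth(2)[OF assms(2,5) l1 L l(2)])
  define M where "M n = scale_measure (inverse (of_nat (N n))) (expected_word_measure \<theta> L R a n v)" for n
  have wl: "weak_limit M (\<mu> a)"
    using assms(6)[of a] unfolding rauzy_measure_def M_def[abs_def] N_def .
  have M_sets: "sets (M n) = sets borel" for n
    by (simp add: M_def sets_expected_word_measure)
  have M_le: "emeasure (M n) A \<le> ennreal (c / real (N n))"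
    if A: "A \<in> sets borel" and c: "0 \<le> c" and
      le: "\<And>w. w \<in> set_pmf (subst_iter \<theta> n v) \<Longrightarrow>
        real (card {m. m < N n \<and> proj L R (abelianise (take m w)) \<in> A}) \<le> c" for n A c
  proof -
    have "emeasure (expected_word_measure \<theta> L R a n v) A \<le> ennreal c"
    proof (rule emeasure_expected_word_measure_le[OF A])
      fix w assume w: "w \<in> set_pmf (subst_iter \<theta> n v)"
      have "card {m. m < length w \<and> w ! m = a \<and> proj L R (abelianise (take m w)) \<in> A}
          \<le> card {m. m < N n \<and> proj L R (abelianise (take m w)) \<in> A}"
        using length_subst_iter[OF assms(2) w] by (intro card_mono) (auto simp: N_def)
      then have "real (card {m. m < length w \<and> w ! m = a \<and> proj L R (abelianise (take m w)) \<in> A}) \<le> c"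
        using le[OF w] by linarith
      then show "emeasure (word_measure L R a w) A \<le> ennreal c"
        by (simp add: emeasure_word_measure[OF A] ennreal_of_nat_eq_real_of_nat ennreal_leI)
    qed
    then have "emeasure (M n) A \<le> inverse (of_nat (N n)) * ennreal c"
      by (simp add: M_def mult_left_mono)
    also have "\<dots> = ennreal (c / real (N n))"
      using N[of n] c by (simp add: ennreal_of_nat_eq_real_of_nat inverse_ennreal ennreal_mult[symmetric] divide_inverse mult.commute)
    finally show ?thesis .
  qed
  have M_fin: "finite_measure (M n)" for n
  proof
    have "emeasure (M n) UNIV \<le> ennreal (real (N n) / real (N n))"
      by (rule M_le) auto
    then show "emeasure (M n) (space (M n)) \<noteq> \<infinity>"
      using sets_eq_imp_space_eq[OF M_sets[of n]] by (auto simp: top_unique)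
  qed

  \<comment> \<open>One \<open>\<epsilon>\<close> is lost to the continuous test function around \<open>C\<close>, the other to the rotation.\<close>
  have thick: "emeasure (\<mu> a) C \<le> ennreal D * emeasure \<nu> {x. infdist x C < 2 * \<epsilon>}"
    if C: "compact C" "C \<noteq> {}" and eps: "0 < \<epsilon>" for C \<epsilon>
  proof -
    let ?A = "{x. infdist x C < \<epsilon>}" and ?U = "{x. infdist x C < 2 * \<epsilon>}"
    have A: "?A \<in> sets borel" and U: "?U \<in> sets borel"
      by (intro borel_open open_Collect_less continuous_intros)+
    define u where "u = measure \<nu> ?U"
    have "emeasure \<nu> ?U < \<infinity>"
    proof -
      obtain \<rho> where "?U \<subseteq> ball 0 \<rho>"
        using thickening_compact(1)[OF C] by blast
      then have "emeasure \<nu> ?U \<le> emeasure \<nu> (ball 0 \<rho>)"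
        by (intro emeasure_mono) (simp_all add: \<nu>)
      then show ?thesis using \<nu>_ball by (rule le_less_trans)
    qed
    then have u: "emeasure \<nu> ?U = ennreal u"
      by (simp add: u_def emeasure_eq_ennreal_measure less_top[symmetric])
    have u0: "0 \<le> u" by (simp add: u_def)
    obtain K where K: "\<And>t. t \<in> ?H \<Longrightarrow> \<exists>k\<le>K. \<exists>j\<in>?J. norm (of_nat k *\<^sub>R ?\<alpha> + j - t) < \<epsilon>"
      using lattice_orbit_uniformly_dense[OF LR R1 indep eps] by blast
    have count: "real (card {m. m < N n \<and> proj L R (abelianise (take m w)) \<in> ?A}) \<le> real (N n + K) * u / \<phi>"
      if w: "w \<in> set_pmf (subst_iter \<theta> n v)" for n w
    proof -
      let ?c = "card {m. m < N n \<and> proj L R (abelianise (take m w)) \<in> ?A}"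
      have "of_nat ?c * emeasure \<nu> F \<le> of_nat (N n + K) * emeasure \<nu> ?U"
      proof (rule visits[OF K U])
        fix y z :: "real ^ 'd" assume "y \<in> ?A" "norm (z - y) < \<epsilon>"
        then show "z \<in> ?U"
          using infdist_triangle[of z C y] by (simp add: dist_norm)
      next
        fix m assume "m < N n"
        then show "proj L R (abelianise (take m w)) - of_nat m *\<^sub>R ?\<alpha> \<in> ?J"
          using length_subst_iter[OF assms(2) w] by (intro prefix_lattice_coset) (simp add: N_def)
      qed
      then have "real ?c * \<phi> \<le> real (N n + K) * u"
        using \<phi> u0 by (simp only: F u ennreal_of_nat_eq_real_of_nat ennreal_mult[symmetric]
            ennreal_le_iff of_nat_0_le_iff mult_nonneg_nonneg less_imp_le)
      then show ?thesis using \<phi> by (simp add: pos_le_divide_eq)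
    qed
    have "emeasure (\<mu> a) C \<le> ennreal ((1 + 0) * (u / \<phi>))"
    proof (rule weak_limit_compact_le[OF wl C eps M_fin M_sets])
      show "emeasure (M n) ?A \<le> ennreal ((1 + real K / real (N n)) * (u / \<phi>))" for n
      proof -
        have "emeasure (M n) ?A \<le> ennreal (real (N n + K) * u / \<phi> / real (N n))"
          using \<phi> u0 by (intro M_le[OF A] count) simp_all
        also have "real (N n + K) * u / \<phi> / real (N n) = (1 + real K / real (N n)) * (u / \<phi>)"
          using N[of n] by (simp add: field_simps)
        finally show ?thesis .
      qed
      show "0 \<le> (1 + real K / real (N n)) * (u / \<phi>)" for n
        using \<phi> u0 by simp
      have "filterlim (\<lambda>n. real (N n)) at_infinity sequentially"
        using N_lim filterlim_at_top_imp_at_infinity filterlim_sequentially_iff_filterlim_real by blast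
      then have "(\<lambda>n. real K / real (N n)) \<longlonglongrightarrow> 0"
        by (intro tendsto_divide_0[OF tendsto_const])
      then show "(\<lambda>n. (1 + real K / real (N n)) * (u / \<phi>)) \<longlonglongrightarrow> (1 + 0) * (u / \<phi>)"
        by (intro tendsto_intros)
    qed
    also have "\<dots> = ennreal D * emeasure \<nu> ?U"
      using \<phi> u0 by (simp add: u D ennreal_mult[symmetric])
    finally show ?thesis .
  qed

  have le: "emeasure (\<mu> a) C \<le> ennreal D * emeasure \<nu> C" if C: "compact C" for C
  proof (cases "C = {}")
    case False
    let ?U = "\<lambda>n :: nat. {x. infdist x C < 2 * (1 / real (Suc n))}"
    have U: "?U n \<in> sets borel" for n
      by (intro borel_open open_Collect_less continuous_intros)
    have "(\<lambda>n. emeasure \<nu> (?U n)) \<longlonglongrightarrow> emeasure \<nu> (\<Inter>n. ?U n)"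
    proof (rule Lim_emeasure_decseq)
      show "range ?U \<subseteq> sets \<nu>" using U \<nu>(1) by auto
      show "decseq ?U"
        by (intro decseq_SucI subsetI CollectI) (auto elim!: less_le_trans intro!: divide_left_mono)
      fix n
      obtain \<rho> where "?U n \<subseteq> ball 0 \<rho>"
        using thickening_compact(1)[OF C False] by blast
      then have "emeasure \<nu> (?U n) \<le> emeasure \<nu> (ball 0 \<rho>)"
        by (intro emeasure_mono) (simp_all add: \<nu>)
      then show "emeasure \<nu> (?U n) \<noteq> \<infinity>" using \<nu>_ball[of \<rho>] by auto
    qed
    then have "(\<lambda>n. ennreal D * emeasure \<nu> (?U n)) \<longlonglongrightarrow> ennreal D * emeasure \<nu> C"
      using thickening_compact(2)[OF C False] by (intro ennreal_tendsto_cmult) simp_all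
    moreover have "emeasure (\<mu> a) C \<le> ennreal D * emeasure \<nu> (?U n)" for n
      by (rule thick[OF C False]) simp
    ultimately show ?thesis
      by (intro LIMSEQ_le_const) auto
  qed simp
  show "absolutely_continuous (lborel_subspace ?H) (\<mu> a) \<and>
      (\<exists>f\<in>borel_measurable borel. \<mu> a = density (lborel_subspace ?H) f \<and> (\<forall>x. f x \<le> ennreal D))"
    using wl unfolding \<nu>_def[symmetric] weak_limit_def
    by (intro bounded_density_if_bounded_on_compacts \<nu> le) auto
qed

end
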